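(* Let $2\le p<\infty$, let $I=[0,2\pi]$, and let $s\in\mathbb{R}$ satisfy $s<\frac12-\frac1{2p}$. Then the maximal estimate $$\Big\|\sup_{t\in I}\big|e^{it\Delta_g}\phi\big|\Big\|_{L^p(\mathbb{S}^2)}\lesssim \|\phi\|_{H^s(\mathbb{S}^2)}$$ fails; that is, there is no constant $C>0$ such that $\big\|\sup_{t\in I}|e^{it\Delta_g}\phi|\big\|_{L^p(\mathbb{S}^2)}\le C\|\phi\|_{H^s(\mathbb{S}^2)}$ holds for all $\phi\in C^\infty(\mathbb{S}^2)$.
   Context: $\mathbb{S}^2$ is the unit two-sphere with its standard round metric $g$, $\Delta_g\le 0$ is its Laplace-Beltrami operator, and $e^{it\Delta_g}$ is the linear Schr\"odinger propagator: if $\phi=\sum_{n\ge0}\pi_n\phi$ is the expansion of $\phi$ in spherical harmonics, with $\pi_n$ the $L^2$-orthogonal projection onto spherical harmonics of degree $n$ (where $-\Delta_g=n(n+1)$), then $e^{it\Delta_g}\phi=\sum_{n\ge0}e^{-itn(n+1)}\pi_n\phi$. The Sobolev norm is $\|\phi\|_{H^s(\mathbb{S}^2)}=\|(1-\Delta_g)^{s/2}\phi\|_{L^2(\mathbb{S}^2)}$. The supremum over $t\in I$ is taken pointwise in $x\in\mathbb{S}^2$. *)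

theory Defs
  imports "HOL-Analysis.Analysis"
begin

section \<open>The round sphere\<close>

abbreviation S2 :: "(real ^ 3) set" where
  "S2 \<equiv> sphere 0 1"

definition spherical_coords :: "real \<times> real \<Rightarrow> real ^ 3" where
  "spherical_coords = (\<lambda>(\<theta>, \<alpha>). vector [sin \<theta> * cos \<alpha>, sin \<theta> * sin \<alpha>, cos \<theta>])"

text \<open>The Riemannian volume of the round metric, which reads
  \<open>d\<theta>\<^sup>2 + sin\<^sup>2 \<theta> d\<alpha>\<^sup>2\<close> in spherical coordinates, so that its density there is \<open>sin \<theta>\<close>.
  Functions on the sphere are represented by functions on the ambient space. The space of the
  measure is \<^term>\<open>S2\<close>, so their values off the sphere affect neither measurability nor
  integrals.\<close>
definition sphere_measure :: "(real ^ 3) measure" where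
  "sphere_measure =
     distr (density lborel
              (\<lambda>(\<theta>, \<alpha>). ennreal (indicator ({0..pi} \<times> {0..2 * pi}) (\<theta>, \<alpha>) * sin \<theta>)))
       (restrict_space borel S2) spherical_coords"

text \<open>As usual for Bochner integrals this is only meaningful if \<open>|f|\<^sup>p\<close> is integrable. Below it
  is applied to bounded measurable functions.\<close>
definition Lp_norm :: "real \<Rightarrow> (real ^ 3 \<Rightarrow> 'a::real_normed_vector) \<Rightarrow> real" where
  "Lp_norm p f = (LINT x|sphere_measure. norm (f x) powr p) powr (1 / p)"


section \<open>Smooth functions and harmonic polynomials\<close>

definition partial_deriv :: "real ^ 3 \<Rightarrow> (real ^ 3 \<Rightarrow> complex) \<Rightarrow> real ^ 3 \<Rightarrow> complex" where
  "partial_deriv b f x = frechet_derivative f (at x) b"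

fun Ck_on :: "nat \<Rightarrow> (real ^ 3) set \<Rightarrow> (real ^ 3 \<Rightarrow> complex) \<Rightarrow> bool" where
  "Ck_on 0 U f \<longleftrightarrow> continuous_on U f"
| "Ck_on (Suc k) U f \<longleftrightarrow>
     f differentiable_on U \<and> (\<forall>b\<in>Basis. Ck_on k U (partial_deriv b f))"

definition smooth_on_S2 :: "(real ^ 3 \<Rightarrow> complex) \<Rightarrow> bool" where
  "smooth_on_S2 \<phi> \<longleftrightarrow>
     (\<exists>U F. open U \<and> S2 \<subseteq> U \<and> (\<forall>k. Ck_on k U F) \<and> (\<forall>x\<in>S2. F x = \<phi> x))"

definition laplacian :: "(real ^ 3 \<Rightarrow> complex) \<Rightarrow> real ^ 3 \<Rightarrow> complex" where
  "laplacian f x = (\<Sum>b\<in>Basis. partial_deriv b (partial_deriv b f) x)"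

text \<open>The spherical harmonics of degree \<open>n\<close> are the restrictions to \<^term>\<open>S2\<close> of the homogeneous
  harmonic polynomials of degree \<open>n\<close>; they are the eigenfunctions of the Laplace--Beltrami operator
  with eigenvalue \<open>- n (n + 1)\<close>. By homogeneity such a polynomial is determined by its restriction,
  so a spherical harmonic is represented by the polynomial itself.\<close>
definition spherical_harmonics :: "nat \<Rightarrow> (real ^ 3 \<Rightarrow> complex) set" where
  "spherical_harmonics n =
     {h. polynomial_function h \<and>
         (\<forall>r x. h (r *\<^sub>R x) = of_real (r ^ n) * h x) \<and>
         (\<forall>x. laplacian h x = 0)}"


section \<open>Spectral calculus of the Laplace--Beltrami operator\<close>

definition harmonic_proj :: "nat \<Rightarrow> (real ^ 3 \<Rightarrow> complex) \<Rightarrow> real ^ 3 \<Rightarrow> complex" where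
  "harmonic_proj n \<phi> =
     (THE h. h \<in> spherical_harmonics n \<and>
        (\<forall>k\<in>spherical_harmonics n. (LINT x|sphere_measure. (\<phi> x - h x) * cnj (k x)) = 0))"

text \<open>The operator \<open>F (- \<Delta>)\<close>. For smooth \<open>\<phi>\<close> and polynomially bounded \<open>F\<close> the series converges
  absolutely and uniformly on \<^term>\<open>S2\<close>, so that pointwise summation gives the continuous
  representative.\<close>
definition fun_of_neg_laplace :: "(real \<Rightarrow> complex) \<Rightarrow> (real ^ 3 \<Rightarrow> complex) \<Rightarrow> real ^ 3 \<Rightarrow> complex" where
  "fun_of_neg_laplace F \<phi> x = (\<Sum>n. F (real n * (real n + 1)) * harmonic_proj n \<phi> x)"

definition schroedinger :: "real \<Rightarrow> (real ^ 3 \<Rightarrow> complex) \<Rightarrow> real ^ 3 \<Rightarrow> complex" where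
  "schroedinger t = fun_of_neg_laplace (\<lambda>\<mu>. exp (- \<i> * of_real (t * \<mu>)))"

definition sobolev_norm :: "real \<Rightarrow> (real ^ 3 \<Rightarrow> complex) \<Rightarrow> real" where
  "sobolev_norm s \<phi> = Lp_norm 2 (fun_of_neg_laplace (\<lambda>\<mu>. of_real ((1 + \<mu>) powr (s / 2))) \<phi>)"

end

theory Submission
  imports Defs
begin

text \<open>The counterexample is a packet of highest weight spherical harmonics travelling around the
  equator. Write \<open>z = x\<^sub>1 + \<i> x\<^sub>2 = \<rho> e\<^sup>i\<^sup>\<alpha>\<close>. The function \<open>z\<^sup>n\<close> is a harmonic polynomial, homogeneous of
  degree \<open>n\<close>, and on the sphere \<open>\<bar>z\<^sup>n\<bar> = \<rho>\<^sup>n\<close> is concentrated on a strip of width of order \<open>n\<^sup>-\<^sup>1\<^sup>/\<^sup>2\<close>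
  around the equator. Let \<open>\<phi>\<close> be the sum of \<open>z\<^sup>n\<close> over the degrees \<open>N \<le> n \<le> N + m\<close> with
  \<open>N = 4 m\<^sup>2\<close>.

  At a point of longitude \<open>\<alpha>\<close> and at the time \<open>t = \<alpha> / (2 N + 1)\<close>, the phases of the terms of
  \<open>e\<^sup>i\<^sup>t\<^sup>\<Delta> \<phi>\<close> differ by less than \<open>pi / 3\<close>, because \<open>t\<close> cancels their part linear in \<open>n - N\<close>
  and the band is too short for the quadratic part to matter. So the maximal function is at least
  \<open>m \<rho>\<^sup>N\<^sup>+\<^sup>m / 2\<close> everywhere (\<open>maximal_function_lower_bound\<close>), which is of order \<open>m\<close> on a strip of
  width of order \<open>1 / m\<close>; its \<open>L\<^sup>p\<close> norm is at least of order \<open>m\<^sup>1\<^sup>-\<^sup>1\<^sup>/\<^sup>p\<close>. On the other hand, by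
  orthogonality the square of the Sobolev norm is a sum of \<open>m + 1\<close> terms of order
  \<open>N\<^sup>2\<^sup>s N\<^sup>-\<^sup>1\<^sup>/\<^sup>2\<close>, so the norm is at most of order \<open>m\<^sup>2\<^sup>s\<close>. For \<open>2 s < 1 - 1 / p\<close> no constant compares the
  two as \<open>m\<close> grows.

  The integrals over the sphere are computed with one identity, \<open>divergence_theorem_sphere\<close>, which reduces to
  the fundamental theorem of calculus in spherical coordinates. Applied to the field
  \<open>f \<nabla>g - g \<nabla>f\<close> it yields the orthogonality of spherical harmonics of different degrees, which
  together with the full support of the measure identifies the spectral projections of \<open>\<phi>\<close>
  (\<open>harmonic_proj_sum\<close>). Applied to \<open>z\<^sup>n\<close> times the conjugate of \<open>z\<^sup>n\<^sup>+\<^sup>1\<close> it yields a recursion for the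
  integrals of \<open>\<rho>\<^sup>2\<^sup>n\<close>, and from it their size up to constants (\<open>highest_weight_mass_bounds\<close>).\<close>


section \<open>Calculus of polynomial maps on space\<close>

lemma real_polynomial_function_has_polynomial_derivative:
  assumes "real_polynomial_function f"
  shows "\<exists>f'. (\<forall>x. (f has_derivative f' x) (at x)) \<and> (\<forall>v. real_polynomial_function (\<lambda>x. f' x v))"
  using assms
proof induction
  case (linear f)
  then show ?case
    by (intro exI[of _ "\<lambda>x. f"])
      (auto intro: bounded_linear_imp_has_derivative real_polynomial_function.intros)
next
  case (const c)
  then show ?case
    by (intro exI[of _ "\<lambda>x v. 0"]) (auto intro: real_polynomial_function.intros)
next
  case (add f g)
  then obtain f' g' where
    "\<And>x. (f has_derivative f' x) (at x)" "\<And>x. (g has_derivative g' x) (at x)"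
    "\<And>v. real_polynomial_function (\<lambda>x. f' x v)" "\<And>v. real_polynomial_function (\<lambda>x. g' x v)"
    by blast
  then show ?case
    by (intro exI[of _ "\<lambda>x v. f' x v + g' x v"])
      (auto intro: has_derivative_add real_polynomial_function.intros)
next
  case (mult f g)
  then obtain f' g' where
    "\<And>x. (f has_derivative f' x) (at x)" "\<And>x. (g has_derivative g' x) (at x)"
    "\<And>v. real_polynomial_function (\<lambda>x. f' x v)" "\<And>v. real_polynomial_function (\<lambda>x. g' x v)"
    by blast
  with mult.hyps show ?case
    by (intro exI[of _ "\<lambda>x v. f x * g' x v + f' x v * g x"])
      (auto intro!: has_derivative_mult real_polynomial_function.intros(3,4))
qed

lemma polynomial_function_complex_iff:
  fixes f :: "'a::euclidean_space \<Rightarrow> complex"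
  shows "polynomial_function f \<longleftrightarrow>
    real_polynomial_function (\<lambda>x. Re (f x)) \<and> real_polynomial_function (\<lambda>x. Im (f x))"
  by (auto simp: polynomial_function_iff_Basis_inner Basis_complex_def inner_complex_def)

lemma polynomial_function_complex_mult:
  fixes f g :: "'a::euclidean_space \<Rightarrow> complex"
  assumes "polynomial_function f" "polynomial_function g"
  shows "polynomial_function (\<lambda>x. f x * g x)"
  using assms unfolding polynomial_function_complex_iff
  by (auto intro!: real_polynomial_function_diff real_polynomial_function.intros(3,4))

lemma polynomial_function_complex_power:
  fixes f :: "'a::euclidean_space \<Rightarrow> complex"
  assumes "polynomial_function f"
  shows "polynomial_function (\<lambda>x. f x ^ n)"
  by (induction n) (auto intro: polynomial_function_complex_mult assms)

lemma polynomial_function_cnj: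
  fixes f :: "'a::euclidean_space \<Rightarrow> complex"
  assumes "polynomial_function f"
  shows "polynomial_function (\<lambda>x. cnj (f x))"
  using assms unfolding polynomial_function_complex_iff
  by (auto intro: real_polynomial_function_minus)

lemma partial_deriv_eq:
  assumes "(f has_derivative f') (at x)"
  shows "partial_deriv b f x = f' b"
  using frechet_derivative_at[OF assms] by (simp add: partial_deriv_def)

lemma polynomial_function_has_derivative:
  assumes "polynomial_function (f :: real ^ 3 \<Rightarrow> complex)"
  shows "(f has_derivative (\<lambda>v. partial_deriv v f x)) (at x)"
  using differentiable_at_polynomial_function[OF assms]
  unfolding frechet_derivative_works partial_deriv_def .

lemma polynomial_function_partial_deriv:
  assumes "polynomial_function f"
  shows "polynomial_function (partial_deriv b f)"
proof -
  obtain u v where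
    u: "\<And>x. ((\<lambda>x. Re (f x)) has_derivative u x) (at x)" "\<And>v. real_polynomial_function (\<lambda>x. u x v)"
    and v: "\<And>x. ((\<lambda>x. Im (f x)) has_derivative v x) (at x)" "\<And>w. real_polynomial_function (\<lambda>x. v x w)"
    using assms unfolding polynomial_function_complex_iff
    by (auto dest!: real_polynomial_function_has_polynomial_derivative)
  have "(f has_derivative (\<lambda>w. Complex (u x w) (v x w))) (at x)" for x
  proof -
    have "((\<lambda>x. of_real (Re (f x)) + \<i> * of_real (Im (f x))) has_derivative
        (\<lambda>w. of_real (u x w) + \<i> * of_real (v x w))) (at x)"
      by (intro has_derivative_add has_derivative_mult_right has_derivative_of_real u(1) v(1))
    then show ?thesis
      by (simp flip: complex_eq Complex_eq)
  qed
  then have "partial_deriv b f = (\<lambda>x. Complex (u x b) (v x b))"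
    by (intro ext) (rule partial_deriv_eq)
  then show ?thesis
    using u(2) v(2) by (simp add: polynomial_function_complex_iff)
qed

lemma Ck_on_polynomial_function:
  assumes "polynomial_function f"
  shows "Ck_on k UNIV f"
  using assms
  by (induction k arbitrary: f)
    (auto intro: continuous_on_polymonial_function differentiable_on_polynomial_function
      polynomial_function_partial_deriv)

lemma smooth_on_S2_polynomial_function: "polynomial_function f \<Longrightarrow> smooth_on_S2 f"
  unfolding smooth_on_S2_def using Ck_on_polynomial_function by blast

lemma partial_deriv_mult:
  assumes "polynomial_function f" "polynomial_function g"
  shows "partial_deriv b (\<lambda>x. f x * g x) x = f x * partial_deriv b g x + partial_deriv b f x * g x"
  by (rule partial_deriv_eq) (intro has_derivative_mult polynomial_function_has_derivative assms)

lemma partial_deriv_diff: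
  assumes "polynomial_function f" "polynomial_function g"
  shows "partial_deriv b (\<lambda>x. f x - g x) x = partial_deriv b f x - partial_deriv b g x"
  by (rule partial_deriv_eq) (intro has_derivative_diff polynomial_function_has_derivative assms)

lemma partial_deriv_cnj:
  assumes "polynomial_function f"
  shows "partial_deriv b (\<lambda>x. cnj (f x)) x = cnj (partial_deriv b f x)"
  by (rule partial_deriv_eq) (intro has_derivative_cnj polynomial_function_has_derivative assms)

lemma partial_deriv_basis_expansion:
  assumes "polynomial_function f"
  shows "partial_deriv v f x = (\<Sum>b\<in>Basis. of_real (v \<bullet> b) * partial_deriv b f x)"
proof -
  interpret linear "\<lambda>v. partial_deriv v f x"
    using polynomial_function_has_derivative[OF assms] by (rule has_derivative_linear)
  have "partial_deriv (\<Sum>b\<in>Basis. (v \<bullet> b) *\<^sub>R b) f x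
      = (\<Sum>b\<in>Basis. of_real (v \<bullet> b) * partial_deriv b f x)"
    unfolding sum scale by (simp add: scaleR_conv_of_real)
  then show ?thesis
    by (simp add: euclidean_representation)
qed

text \<open>Real degrees and positive dilations only: in this form a partial derivative of a function of
  degree \<open>c\<close> has degree \<open>c - 1\<close> in every case, including \<open>c = 0\<close>, and no subtraction of
  natural numbers intervenes.\<close>
definition homogeneous :: "real \<Rightarrow> (real ^ 3 \<Rightarrow> complex) \<Rightarrow> bool" where
  "homogeneous c f \<longleftrightarrow> (\<forall>r>0. \<forall>x. f (r *\<^sub>R x) = of_real (r powr c) * f x)"

lemma homogeneous_mult:
  assumes "homogeneous c f" "homogeneous d g"
  shows "homogeneous (c + d) (\<lambda>x. f x * g x)"
  using assms by (simp add: homogeneous_def powr_add)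

lemma homogeneous_diff:
  assumes "homogeneous c f" "homogeneous c g"
  shows "homogeneous c (\<lambda>x. f x - g x)"
  using assms by (simp add: homogeneous_def algebra_simps)

lemma homogeneous_partial_deriv:
  assumes f: "polynomial_function f" and hom: "homogeneous c f"
  shows "homogeneous (c - 1) (partial_deriv b f)"
  unfolding homogeneous_def
proof (intro allI impI)
  fix r :: real and x :: "real ^ 3"
  assume r: "r > 0"
  have "((\<lambda>x. f (r *\<^sub>R x)) has_derivative (\<lambda>v. partial_deriv (r *\<^sub>R v) f (r *\<^sub>R x))) (at x)"
    by (rule has_derivative_compose[of "\<lambda>x. r *\<^sub>R x" "\<lambda>x. r *\<^sub>R x" x UNIV f])
      (auto intro!: derivative_eq_intros polynomial_function_has_derivative f)
  then have "((\<lambda>x. of_real (r powr c) * f x) has_derivative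
      (\<lambda>v. partial_deriv (r *\<^sub>R v) f (r *\<^sub>R x))) (at x)"
    using hom r by (simp add: homogeneous_def)
  moreover have "((\<lambda>x. of_real (r powr c) * f x) has_derivative
      (\<lambda>v. of_real (r powr c) * partial_deriv v f x)) (at x)"
    by (intro has_derivative_mult_right polynomial_function_has_derivative f)
  ultimately have "partial_deriv (r *\<^sub>R b) f (r *\<^sub>R x) = of_real (r powr c) * partial_deriv b f x"
    by (metis has_derivative_unique)
  moreover have "partial_deriv (r *\<^sub>R b) f (r *\<^sub>R x) = r *\<^sub>R partial_deriv b f (r *\<^sub>R x)"
    using has_derivative_linear[OF polynomial_function_has_derivative[OF f]] by (rule linear_scale)
  ultimately have "of_real r * partial_deriv b f (r *\<^sub>R x)
      = of_real r * (of_real (r powr (c - 1)) * partial_deriv b f x)"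
    using r by (simp add: scaleR_conv_of_real powr_diff field_simps)
  then show "partial_deriv b f (r *\<^sub>R x) = of_real (r powr (c - 1)) * partial_deriv b f x"
    using r by simp
qed

lemma has_vector_derivative_polynomial_along_curve:
  assumes f: "polynomial_function f" and g: "(g has_vector_derivative v) (at t)"
  shows "((\<lambda>t. f (g t)) has_vector_derivative partial_deriv v f (g t)) (at t)"
proof -
  have "((\<lambda>t. f (g t)) has_derivative (\<lambda>h. partial_deriv (h *\<^sub>R v) f (g t))) (at t)"
    by (rule has_derivative_compose[OF g[unfolded has_vector_derivative_def]])
      (rule polynomial_function_has_derivative[OF f])
  moreover have "partial_deriv (h *\<^sub>R v) f (g t) = h *\<^sub>R partial_deriv v f (g t)" for h
    using has_derivative_linear[OF polynomial_function_has_derivative[OF f]] by (rule linear_scale)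
  ultimately show ?thesis
    by (simp add: has_vector_derivative_def)
qed

lemma Euler_homogeneous:
  assumes f: "polynomial_function f" and hom: "homogeneous c f"
  shows "partial_deriv x f x = of_real c * f x"
proof -
  have "((\<lambda>r. f (r *\<^sub>R x)) has_vector_derivative partial_deriv x f (1 *\<^sub>R x)) (at (1::real))"
    by (rule has_vector_derivative_polynomial_along_curve[OF f]) (auto intro!: derivative_eq_intros)
  moreover have "((\<lambda>r. f (r *\<^sub>R x)) has_vector_derivative of_real c * f x) (at 1)"
  proof (rule has_vector_derivative_transform_within_open)
    have "((\<lambda>r. r powr c) has_real_derivative c) (at 1)"
      by (auto intro!: derivative_eq_intros)
    then show "((\<lambda>r. of_real (r powr c) * f x) has_vector_derivative of_real c * f x) (at 1)"
      by (intro has_vector_derivative_mult_left has_vector_derivative_of_real)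
        (simp add: has_real_derivative_iff_has_vector_derivative)
    show "open {0::real<..}" "1 \<in> {0::real<..}" by auto
    show "of_real (r powr c) * f x = f (r *\<^sub>R x)" if "r \<in> {0<..}" for r
      using hom that by (simp add: homogeneous_def)
  qed
  ultimately show ?thesis
    by (simp add: vector_derivative_unique_at)
qed


section \<open>Integration over the sphere\<close>

lemma spherical_coords_nth [simp]:
  "spherical_coords (\<theta>, \<alpha>) $ 1 = sin \<theta> * cos \<alpha>"
  "spherical_coords (\<theta>, \<alpha>) $ 2 = sin \<theta> * sin \<alpha>"
  "spherical_coords (\<theta>, \<alpha>) $ 3 = cos \<theta>"
  by (auto simp: spherical_coords_def)

lemma S2_iff: "x \<in> S2 \<longleftrightarrow> (x $ 1)\<^sup>2 + (x $ 2)\<^sup>2 + (x $ 3)\<^sup>2 = 1"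
  by (simp add: norm_vec_def L2_set_def sum_3)

lemma norm_spherical_coords [simp]: "norm (spherical_coords z) = 1"
proof (cases z)
  case (Pair \<theta> \<alpha>)
  have "(sin \<theta> * cos \<alpha>)\<^sup>2 + (sin \<theta> * sin \<alpha>)\<^sup>2 + (cos \<theta>)\<^sup>2
      = (sin \<theta>)\<^sup>2 * ((sin \<alpha>)\<^sup>2 + (cos \<alpha>)\<^sup>2) + (cos \<theta>)\<^sup>2"
    unfolding power_mult_distrib by (simp only: algebra_simps)
  then show ?thesis 
    using S2_iff[of "spherical_coords z"] by (simp add: Pair)
qed

lemma continuous_on_spherical_coords: "continuous_on UNIV spherical_coords"
  unfolding continuous_on_componentwise[of _ spherical_coords]
proof
  fix b :: "real ^ 3"
  assume "b \<in> Basis"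
  then obtain i where b: "b = axis i 1"
    by (auto simp: Basis_vec_def)
  have "(\<lambda>z. spherical_coords z $ i) = (\<lambda>z. if i = 1 then sin (fst z) * cos (snd z)
      else if i = 2 then sin (fst z) * sin (snd z) else cos (fst z))"
    using exhaust_3[of i] by auto
  moreover have "continuous_on UNIV \<dots>"
    by (cases "i = 1"; cases "i = 2") (auto intro!: continuous_intros)
  ultimately show "continuous_on UNIV (\<lambda>z. spherical_coords z \<bullet> b)"
    by (simp only: b inner_axis inner_real_def mult_1_right)
qed

lemma spherical_coords_surj:
  assumes "x \<in> S2"
  shows "\<exists>\<theta>\<in>{0..pi}. \<exists>\<alpha>\<in>{0..2 * pi}. x = spherical_coords (\<theta>, \<alpha>)"
proof -
  define w where "w = Complex (x $ 1) (x $ 2)"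
  have sq: "(x $ 1)\<^sup>2 + (x $ 2)\<^sup>2 + (x $ 3)\<^sup>2 = 1"
    using assms by (simp only: S2_iff)
  have x3: "\<bar>x $ 3\<bar> \<le> 1"
    using sq abs_square_le_1[of "x $ 3"] by (smt (verit) zero_le_power2)
  have "cmod w = sqrt (1 - (x $ 3)\<^sup>2)"
    unfolding w_def complex_norm complex.sel using sq by (intro arg_cong[of _ _ sqrt]) linarith
  also have "\<dots> = sin (arccos (x $ 3))"
    using x3 by (simp add: sin_arccos_abs)
  finally have cw: "cmod w = sin (arccos (x $ 3))" .
  have "w = of_real (sin (arccos (x $ 3))) * exp (\<i> * of_real (Arg2pi w))"
    using Arg2pi_eq[of w] cw by simp
  then have "x $ 1 = sin (arccos (x $ 3)) * cos (Arg2pi w)"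
    "x $ 2 = sin (arccos (x $ 3)) * sin (Arg2pi w)"
    unfolding w_def complex_eq_iff by (simp_all add: Re_exp Im_exp)
  then have "x = spherical_coords (arccos (x $ 3), Arg2pi w)"
    using x3 by (simp add: vec_eq_iff forall_3 cos_arccos_abs)
  moreover have "arccos (x $ 3) \<in> {0..pi}"
    using x3 arccos_lbound arccos_ubound by (auto simp: abs_le_iff)
  moreover have "Arg2pi w \<in> {0..2 * pi}"
    using Arg2pi[of w] by auto
  ultimately show ?thesis by blast
qed

lemma space_sphere_measure [simp]: "space sphere_measure = S2"
  by (simp add: sphere_measure_def space_restrict_space)

lemma sets_sphere_measure: "sets sphere_measure = sets (restrict_space borel S2)"
  by (simp add: sphere_measure_def)

lemma borel_measurable_sphere_measure:
  assumes "continuous_on S2 f"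
  shows "f \<in> borel_measurable sphere_measure"
  using borel_measurable_continuous_on_restrict[OF assms]
  by (simp add: measurable_cong_sets[OF sets_sphere_measure refl])

lemma measurable_spherical_coords: "spherical_coords \<in> measurable borel (restrict_space borel S2)"
  using borel_measurable_continuous_onI[OF continuous_on_spherical_coords]
  by (auto intro!: measurable_restrict_space2)

lemma borel_measurable_sphere_density:
  "(\<lambda>(\<theta>, \<alpha>). indicator ({0..pi} \<times> {0..2 * pi}) (\<theta>, \<alpha>) * sin \<theta> :: real) \<in> borel_measurable borel"
proof -
  have "{0..pi} \<times> {0..2 * pi} \<in> sets (borel :: (real \<times> real) measure)"
    by (intro borel_closed closed_Times) auto
  moreover have "(\<lambda>z::real\<times>real. sin (fst z)) \<in> borel_measurable borel"
    by (intro borel_measurable_continuous_onI continuous_intros)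
  ultimately show ?thesis
    unfolding case_prod_beta by auto
qed

lemma continuous_on_spherical_integrand:
  fixes f :: "real ^ 3 \<Rightarrow> 'b::euclidean_space"
  assumes "continuous_on S2 f"
  shows "continuous_on A (\<lambda>(\<theta>, \<alpha>). sin \<theta> *\<^sub>R f (spherical_coords (\<theta>, \<alpha>)))"
proof -
  have "continuous_on A (\<lambda>z. f (spherical_coords z))"
    by (rule continuous_on_compose2[OF assms continuous_on_subset[OF continuous_on_spherical_coords]])
      (auto)
  then show ?thesis
    unfolding case_prod_beta by (auto intro!: continuous_intros)
qed

lemma integral_sphere_measure:
  fixes f :: "real ^ 3 \<Rightarrow> 'b::euclidean_space"
  assumes f: "continuous_on S2 f"
  shows "(LINT x|sphere_measure. f x)
    = integral (cbox (0, 0) (pi, 2 * pi)) (\<lambda>(\<theta>, \<alpha>). sin \<theta> *\<^sub>R f (spherical_coords (\<theta>, \<alpha>)))"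
proof -
  let ?d = "\<lambda>(\<theta>, \<alpha>). indicator ({0..pi} \<times> {0..2 * pi}) (\<theta>, \<alpha>) * sin \<theta> :: real"
  let ?F = "\<lambda>(\<theta>, \<alpha>). sin \<theta> *\<^sub>R f (spherical_coords (\<theta>, \<alpha>))"
  have d: "(\<lambda>(\<theta>, \<alpha>). ennreal (indicator ({0..pi} \<times> {0..2 * pi}) (\<theta>, \<alpha>) * sin \<theta>)) = (\<lambda>z. ennreal (?d z))"
    by auto
  have box: "cbox (0, 0) (pi, 2 * pi) = {0..pi} \<times> {0..2 * pi}"
    by (simp add: cbox_Pair_eq)
  have "(LINT x|sphere_measure. f x) = (LINT z|density lborel (\<lambda>z. ennreal (?d z)). f (spherical_coords z))"
    unfolding sphere_measure_def d
    using measurable_spherical_coords borel_measurable_continuous_on_restrict[OF f]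
    by (subst integral_distr) (auto simp: measurable_def)
  also have "\<dots> = (LINT z|lborel. ?d z *\<^sub>R f (spherical_coords z))"
    using borel_measurable_sphere_density
      measurable_compose[OF measurable_spherical_coords borel_measurable_continuous_on_restrict[OF f]]
    by (intro integral_density AE_I2) (auto simp: indicator_def sin_ge_zero)
  also have "\<dots> = (LINT z:cbox (0, 0) (pi, 2 * pi)|lborel. ?F z)"
    unfolding set_lebesgue_integral_def box
    by (intro Bochner_Integration.integral_cong) (auto simp: indicator_def)
  also have "\<dots> = integral (cbox (0, 0) (pi, 2 * pi)) ?F"
    unfolding set_integrable_def
    by (intro set_borel_integral_eq_integral borel_integrable_compact compact_cbox
        continuous_on_spherical_integrand f) (auto simp: set_integrable_def intro!: borel_integrable_compact
        continuous_on_spherical_integrand f)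
  finally show ?thesis .
qed

lemma finite_measure_sphere_measure: "finite_measure sphere_measure"
proof
  let ?R = "{0..pi} \<times> {0..2 * pi}"
  let ?d = "\<lambda>(\<theta>, \<alpha>). indicator ?R (\<theta>, \<alpha>) * sin \<theta> :: real"
  have d: "(\<lambda>(\<theta>, \<alpha>). ennreal (indicator ?R (\<theta>, \<alpha>) * sin \<theta>)) = (\<lambda>z. ennreal (?d z))"
    by auto
  have R: "?R = cbox (0, 0) (pi, 2 * pi)"
    by (simp add: cbox_Pair_eq)
  have S2: "S2 \<in> sets (restrict_space borel S2)"
    using sets.top[of "restrict_space borel S2"] by (simp add: space_restrict_space)
  have "emeasure sphere_measure S2 = emeasure (density lborel (\<lambda>z. ennreal (?d z))) UNIV"
    unfolding sphere_measure_def d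
    using measurable_spherical_coords S2 by (subst emeasure_distr) (auto simp: measurable_def vimage_def)
  also have "\<dots> = (\<integral>\<^sup>+z. ennreal (?d z) \<partial>lborel)"
    using borel_measurable_sphere_density by (subst emeasure_density) auto
  also have "\<dots> \<le> (\<integral>\<^sup>+z. indicator ?R z \<partial>lborel)"
  proof (intro nn_integral_mono)
    fix z
    show "ennreal (?d z) \<le> indicator ?R z"
      by (cases z; cases "z \<in> ?R") (auto simp: ennreal_le_1 indicator_def)
  qed
  also have "\<dots> < \<infinity>"
    unfolding R using emeasure_lborel_cbox_finite by simp
  finally show "emeasure sphere_measure (space sphere_measure) \<noteq> \<infinity>"
    by simp
qed

lemma integrable_sphere_measure:
  fixes f :: "real ^ 3 \<Rightarrow> 'b::euclidean_space"
  assumes "continuous_on S2 f"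
  shows "integrable sphere_measure f"
proof -
  interpret finite_measure sphere_measure
    by (rule finite_measure_sphere_measure)
  obtain B where "\<And>x. x \<in> S2 \<Longrightarrow> norm (f x) \<le> B"
    using compact_imp_bounded[OF compact_continuous_image[OF assms]] compact_sphere
    unfolding bounded_iff by (metis imageI)
  then show ?thesis
    by (intro integrable_const_bound[of _ B] AE_I2 borel_measurable_sphere_measure assms) simp_all
qed

text \<open>The integral is that of the continuous nonnegative function \<open>sin \<theta> f\<close> over a rectangle, which
  can only vanish if the integrand does.\<close>
lemma sphere_measure_full_support:
  fixes f :: "real ^ 3 \<Rightarrow> real"
  assumes f: "continuous_on S2 f" and nonneg: "\<And>x. x \<in> S2 \<Longrightarrow> 0 \<le> f x"
    and zero: "(LINT x|sphere_measure. f x) = 0" and x: "x \<in> S2"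
  shows "f x = 0"
proof -
  let ?F = "\<lambda>(\<theta>, \<alpha>). sin \<theta> *\<^sub>R f (spherical_coords (\<theta>, \<alpha>))"
  have "?F integrable_on cbox (0, 0) (pi, 2 * pi)"
    by (intro integrable_continuous continuous_on_spherical_integrand f)
  then have int: "(?F has_integral 0) (cbox (0, 0) (pi, 2 * pi))"
    using zero integral_sphere_measure[OF f] by (simp add: has_integral_integral)
  have F: "?F z = 0" if "z \<in> cbox (0, 0) (pi, 2 * pi)" for z
  proof (rule has_integral_0_cbox_imp_0[OF _ _ int _ that])
    show "continuous_on (cbox (0, 0) (pi, 2 * pi)) ?F"
      by (intro continuous_on_spherical_integrand f)
    show "0 \<le> ?F z" if "z \<in> box (0, 0) (pi, 2 * pi)" for z
      using that by (auto simp: box_prod intro!: mult_nonneg_nonneg sin_ge_zero nonneg)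
    show "box (0, 0) (pi, 2 * pi) \<noteq> {}"
      by (simp add: box_ne_empty Basis_prod_def)
  qed
  obtain \<theta> \<alpha> where \<theta>: "\<theta> \<in> {0..pi}" and \<alpha>: "\<alpha> \<in> {0..2 * pi}" and x_eq: "x = spherical_coords (\<theta>, \<alpha>)"
    using spherical_coords_surj[OF x] by blast
  \<comment> \<open>The density vanishes at the poles, so these are reached by continuity along a meridian.\<close>
  have "f (spherical_coords (\<theta>, \<alpha>)) = 0"
  proof (rule continuous_constant_on_closure[of "{0<..<pi}" "\<lambda>\<theta>. f (spherical_coords (\<theta>, \<alpha>))"])
    have "continuous_on A (\<lambda>\<theta>. spherical_coords (\<theta>, \<alpha>))" for A
      by (rule continuous_on_compose2[OF continuous_on_spherical_coords]) (auto intro!: continuous_intros)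
    then show "continuous_on (closure {0<..<pi}) (\<lambda>\<theta>. f (spherical_coords (\<theta>, \<alpha>)))"
      by (rule continuous_on_compose2[OF f]) auto
    show "f (spherical_coords (\<theta>, \<alpha>)) = 0" if "\<theta> \<in> {0<..<pi}" for \<theta>
      using F[of "(\<theta>, \<alpha>)"] that \<alpha> sin_gt_zero[of \<theta>] by (auto simp: cbox_Pair_eq)
    show "\<theta> \<in> closure {0<..<pi}"
      using \<theta> by simp
  qed
  then show ?thesis by (simp add: x_eq)
qed


section \<open>The divergence theorem on the sphere\<close>

text \<open>Each of the two terms integrates to zero along its own variable first, by the fundamental
  theorem of calculus. In the spherical chart, the condition on the sides \<open>\<theta> = 0\<close> and \<open>\<theta> = pi\<close> will
  come from a factor \<open>sin \<theta>\<close>, the one on the other two sides from periodicity.\<close>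
lemma integral_divergence_periodic_rectangle:
  fixes P Q P' Q' :: "real \<Rightarrow> real \<Rightarrow> 'a::banach"
  assumes P: "\<And>\<theta> \<alpha>. ((\<lambda>\<theta>. P \<theta> \<alpha>) has_vector_derivative P' \<theta> \<alpha>) (at \<theta>)"
    and Q: "\<And>\<theta> \<alpha>. (Q \<theta> has_vector_derivative Q' \<theta> \<alpha>) (at \<alpha>)"
    and cont: "continuous_on UNIV (\<lambda>(\<theta>, \<alpha>). P' \<theta> \<alpha>)" "continuous_on UNIV (\<lambda>(\<theta>, \<alpha>). Q' \<theta> \<alpha>)"
    and bdry: "\<And>\<alpha>. P a \<alpha> = P b \<alpha>" "\<And>\<theta>. Q \<theta> c = Q \<theta> d" and le: "a \<le> b" "c \<le> d"
  shows "integral (cbox (a, c) (b, d)) (\<lambda>(\<theta>, \<alpha>). P' \<theta> \<alpha> + Q' \<theta> \<alpha>) = 0"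
proof -
  note cont' = cont[THEN continuous_on_subset, OF subset_UNIV]
  have "integral {c..d} (Q' \<theta>) = 0" for \<theta>
  proof -
    have "(Q' \<theta> has_integral (Q \<theta> d - Q \<theta> c)) {c..d}"
      by (intro fundamental_theorem_of_calculus le has_vector_derivative_at_within[OF Q])
    then show ?thesis
      using bdry by (simp add: integral_unique)
  qed
  then have Q0: "integral (cbox (a, c) (b, d)) (\<lambda>(\<theta>, \<alpha>). Q' \<theta> \<alpha>) = 0"
    by (subst integral_prod_continuous[OF cont'(2)]) simp
  have "integral {a..b} (\<lambda>\<theta>. P' \<theta> \<alpha>) = 0" for \<alpha>
  proof -
    have "((\<lambda>\<theta>. P' \<theta> \<alpha>) has_integral (P b \<alpha> - P a \<alpha>)) {a..b}"
      by (intro fundamental_theorem_of_calculus[of a b "\<lambda>\<theta>. P \<theta> \<alpha>"] le has_vector_derivative_at_within[OF P])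
    then show ?thesis
      using bdry by (simp add: integral_unique)
  qed
  then have "integral (cbox c d) (\<lambda>\<alpha>. integral (cbox a b) (\<lambda>\<theta>. P' \<theta> \<alpha>)) = 0"
    by simp
  then have P0: "integral (cbox (a, c) (b, d)) (\<lambda>(\<theta>, \<alpha>). P' \<theta> \<alpha>) = 0"
    by (subst integral_prod_continuous[OF cont'(1)]) (simp add: integral_swap_continuous[OF cont'(1), unfolded cbox_interval])
  have "integral (cbox (a, c) (b, d)) (\<lambda>z. (case z of (\<theta>, \<alpha>) \<Rightarrow> P' \<theta> \<alpha>) + (case z of (\<theta>, \<alpha>) \<Rightarrow> Q' \<theta> \<alpha>)) = 0"
    by (subst integral_add) (auto intro!: integrable_continuous cont' simp: P0 Q0)
  then show ?thesis
    by (simp add: case_prod_unfold)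
qed

lemma spherical_coords_axis:
  "spherical_coords (\<theta>, \<alpha>)
    = (sin \<theta> * cos \<alpha>) *\<^sub>R axis 1 1 + (sin \<theta> * sin \<alpha>) *\<^sub>R axis 2 1 + cos \<theta> *\<^sub>R axis 3 1"
  by (simp add: vec_eq_iff forall_3 axis_def)

text \<open>The two definitions below give the orthonormal frame of the tangent planes, pointing along the
  meridian and the parallel. The \<open>\<theta>\<close>-derivative of the chart is the first vector, the
  \<open>\<alpha>\<close>-derivative is \<open>sin \<theta>\<close> times the second.\<close>
definition south_dir :: "real \<Rightarrow> real \<Rightarrow> real ^ 3" where
  "south_dir \<theta> \<alpha> = (cos \<theta> * cos \<alpha>) *\<^sub>R axis 1 1 + (cos \<theta> * sin \<alpha>) *\<^sub>R axis 2 1 - sin \<theta> *\<^sub>R axis 3 1"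

definition east_dir :: "real \<Rightarrow> real ^ 3" where
  "east_dir \<alpha> = cos \<alpha> *\<^sub>R axis 2 1 - sin \<alpha> *\<^sub>R axis 1 1"

lemma orthonormal_frame_expansion:
  "(south_dir \<theta> \<alpha> \<bullet> b) *\<^sub>R south_dir \<theta> \<alpha> + (east_dir \<alpha> \<bullet> b) *\<^sub>R east_dir \<alpha>
    = b - (spherical_coords (\<theta>, \<alpha>) \<bullet> b) *\<^sub>R spherical_coords (\<theta>, \<alpha>)"
proof -
  have c: "(cos \<alpha>)\<^sup>2 = 1 - (sin \<alpha>)\<^sup>2" "(cos \<theta>)\<^sup>2 = 1 - (sin \<theta>)\<^sup>2"
    by (simp_all add: cos_squared_eq)
  show ?thesis
    unfolding vec_eq_iff forall_3 inner_vec_def sum_3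
    by (simp add: south_dir_def east_dir_def axis_def; intro conjI; algebra add: c)
qed

text \<open>This is the divergence theorem in the unit ball for the field \<open>f b\<close>, where homogeneity turns the
  integral of \<open>\<partial>\<^sub>b f\<close> over the ball, of degree \<open>c - 1\<close>, into \<open>1 / (c + 2)\<close> times that over the
  sphere. It is proved on the sphere itself: the tangential part \<open>S\<close> of \<open>b\<close> has divergence
  \<open>- 2 (x \<bullet> b)\<close>, so that the integral of \<open>S f - 2 (x \<bullet> b) f\<close>, where \<open>S\<close> acts as a derivation,
  vanishes, and \<open>S f = \<partial>\<^sub>b f - (x \<bullet> b) c f\<close> by Euler's identity. In the chart, \<open>S\<close> multiplied by the
  density \<open>sin \<theta>\<close> has the coordinates \<open>sin \<theta> (south \<bullet> b)\<close> and \<open>east \<bullet> b\<close>, both regular at the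
  poles.\<close>
lemma divergence_theorem_sphere:
  assumes f: "polynomial_function f" and hom: "homogeneous c f"
  shows "(LINT x|sphere_measure. partial_deriv b f x)
    = of_real (c + 2) * (LINT x|sphere_measure. of_real (x \<bullet> b) * f x)"
proof -
  note pd = polynomial_function_partial_deriv[OF f]
  let ?X = "\<lambda>\<theta> \<alpha>. spherical_coords (\<theta>, \<alpha>)"
  let ?P = "\<lambda>\<theta> \<alpha>. (sin \<theta> * (south_dir \<theta> \<alpha> \<bullet> b)) *\<^sub>R f (?X \<theta> \<alpha>)"
  let ?Q = "\<lambda>\<theta> \<alpha>. (east_dir \<alpha> \<bullet> b) *\<^sub>R f (?X \<theta> \<alpha>)"
  let ?P' = "\<lambda>\<theta> \<alpha>. (sin \<theta> * (south_dir \<theta> \<alpha> \<bullet> b)) *\<^sub>R partial_deriv (south_dir \<theta> \<alpha>) f (?X \<theta> \<alpha>)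
      + ((cos \<theta> *\<^sub>R south_dir \<theta> \<alpha> - sin \<theta> *\<^sub>R ?X \<theta> \<alpha>) \<bullet> b) *\<^sub>R f (?X \<theta> \<alpha>)"
  let ?Q' = "\<lambda>\<theta> \<alpha>. (east_dir \<alpha> \<bullet> b) *\<^sub>R partial_deriv (sin \<theta> *\<^sub>R east_dir \<alpha>) f (?X \<theta> \<alpha>)
      + ((- cos \<alpha> *\<^sub>R axis 1 1 - sin \<alpha> *\<^sub>R axis 2 1) \<bullet> b) *\<^sub>R f (?X \<theta> \<alpha>)"
  have X\<theta>: "((\<lambda>\<theta>. ?X \<theta> \<alpha>) has_vector_derivative south_dir \<theta> \<alpha>) (at \<theta>)" for \<theta> \<alpha>
    unfolding spherical_coords_axis south_dir_def
    by (auto intro!: derivative_eq_intros)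
  have X\<alpha>: "((\<lambda>\<alpha>. ?X \<theta> \<alpha>) has_vector_derivative sin \<theta> *\<^sub>R east_dir \<alpha>) (at \<alpha>)" for \<theta> \<alpha>
    unfolding spherical_coords_axis east_dir_def
    by (auto intro!: derivative_eq_intros simp: algebra_simps)
  have "((\<lambda>\<theta>. sin \<theta> * (south_dir \<theta> \<alpha> \<bullet> b)) has_real_derivative
      (cos \<theta> *\<^sub>R south_dir \<theta> \<alpha> - sin \<theta> *\<^sub>R ?X \<theta> \<alpha>) \<bullet> b) (at \<theta>)" for \<theta> \<alpha>
    unfolding spherical_coords_axis south_dir_def inner_add_left inner_diff_left inner_scaleR_left
    by (auto intro!: derivative_eq_intros simp: algebra_simps)
  then have P: "((\<lambda>\<theta>. ?P \<theta> \<alpha>) has_vector_derivative ?P' \<theta> \<alpha>) (at \<theta>)" for \<theta> \<alpha>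
    by (intro has_vector_derivative_scaleR has_vector_derivative_polynomial_along_curve f X\<theta>)
  have "((\<lambda>\<alpha>. east_dir \<alpha> \<bullet> b) has_real_derivative
      (- cos \<alpha> *\<^sub>R axis 1 1 - sin \<alpha> *\<^sub>R axis 2 1) \<bullet> b) (at \<alpha>)" for \<alpha>
    unfolding east_dir_def inner_add_left inner_diff_left inner_scaleR_left
    by (auto intro!: derivative_eq_intros)
  then have Q: "((\<lambda>\<alpha>. ?Q \<theta> \<alpha>) has_vector_derivative ?Q' \<theta> \<alpha>) (at \<alpha>)" for \<theta> \<alpha>
    by (intro has_vector_derivative_scaleR has_vector_derivative_polynomial_along_curve f X\<alpha>)
  have contX: "continuous_on UNIV (\<lambda>z. g (?X (fst z) (snd z)))" if "polynomial_function g"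
    for g :: "real ^ 3 \<Rightarrow> complex"
    using continuous_on_compose2[OF continuous_on_polymonial_function[OF that, of UNIV]
        continuous_on_spherical_coords]
    by simp
  have contX': "continuous_on UNIV (\<lambda>z. spherical_coords (fst z, snd z))"
    using continuous_on_spherical_coords by simp
  have cont: "continuous_on UNIV (\<lambda>(\<theta>, \<alpha>). ?P' \<theta> \<alpha>)" "continuous_on UNIV (\<lambda>(\<theta>, \<alpha>). ?Q' \<theta> \<alpha>)"
    unfolding case_prod_beta partial_deriv_basis_expansion[OF f, of "south_dir _ _"]
      partial_deriv_basis_expansion[OF f, of "_ *\<^sub>R east_dir _"]
    unfolding south_dir_def east_dir_def
    by (intro continuous_intros contX contX' f pd)+
  have "integral (cbox (0, 0) (pi, 2 * pi)) (\<lambda>(\<theta>, \<alpha>). ?P' \<theta> \<alpha> + ?Q' \<theta> \<alpha>) = 0"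
  proof (rule integral_divergence_periodic_rectangle[OF P Q cont])
    have "?X \<theta> 0 = ?X \<theta> (2 * pi)" for \<theta>
      by (simp add: vec_eq_iff forall_3)
    then show "?Q \<theta> 0 = ?Q \<theta> (2 * pi)" for \<theta>
      by (simp add: east_dir_def)
  qed auto
  moreover have "?P' \<theta> \<alpha> + ?Q' \<theta> \<alpha> = sin \<theta> *\<^sub>R (partial_deriv b f (?X \<theta> \<alpha>)
      - of_real (c + 2) * (of_real (?X \<theta> \<alpha> \<bullet> b) * f (?X \<theta> \<alpha>)))" for \<theta> \<alpha>
  proof -
    interpret linear "\<lambda>v. partial_deriv v f (?X \<theta> \<alpha>)"
      using polynomial_function_has_derivative[OF f] by (rule has_derivative_linear)
    let ?S = "south_dir \<theta> \<alpha>" and ?E = "east_dir \<alpha>" and ?x = "?X \<theta> \<alpha>"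
    let ?u = "cos \<theta> *\<^sub>R ?S - sin \<theta> *\<^sub>R ?x" and ?w = "- cos \<alpha> *\<^sub>R axis 1 1 - sin \<alpha> *\<^sub>R axis 2 1 :: real ^ 3"
    have "partial_deriv ((?S \<bullet> b) *\<^sub>R ?S + (?E \<bullet> b) *\<^sub>R ?E) f ?x = partial_deriv (b - (?x \<bullet> b) *\<^sub>R ?x) f ?x"
      by (simp only: orthonormal_frame_expansion)
    then have frame: "(?S \<bullet> b) *\<^sub>R partial_deriv ?S f ?x + (?E \<bullet> b) *\<^sub>R partial_deriv ?E f ?x
        = partial_deriv b f ?x - (?x \<bullet> b) *\<^sub>R (of_real c * f ?x)"
      by (simp only: add diff scale Euler_homogeneous[OF f hom])
    have "?u + ?w = (- 2 * sin \<theta>) *\<^sub>R ?x"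
    proof -
      have c: "(cos \<theta>)\<^sup>2 = 1 - (sin \<theta>)\<^sup>2"
        by (simp add: cos_squared_eq)
      show ?thesis
        unfolding vec_eq_iff forall_3
        by (simp add: south_dir_def axis_def; intro conjI; algebra add: c)
    qed
    then have curv: "?u \<bullet> b + ?w \<bullet> b = - 2 * sin \<theta> * (?x \<bullet> b)"
      by (metis inner_add_left inner_scaleR_left)
    have "?P' \<theta> \<alpha> + ?Q' \<theta> \<alpha> = sin \<theta> *\<^sub>R ((?S \<bullet> b) *\<^sub>R partial_deriv ?S f ?x
        + (?E \<bullet> b) *\<^sub>R partial_deriv ?E f ?x) + (?u \<bullet> b + ?w \<bullet> b) *\<^sub>R f ?x"
      unfolding scale scaleR_add_left[of "?u \<bullet> b"] scaleR_add_right by (simp add: mult.commute)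
    also have "\<dots> = sin \<theta> *\<^sub>R (partial_deriv b f ?x - of_real (c + 2) * (of_real (?x \<bullet> b) * f ?x))"
      unfolding frame curv by (simp add: scaleR_conv_of_real algebra_simps)
    finally show ?thesis .
  qed
  moreover have "(LINT x|sphere_measure. partial_deriv b f x - of_real (c + 2) * (of_real (x \<bullet> b) * f x))
    = integral (cbox (0, 0) (pi, 2 * pi)) (\<lambda>(\<theta>, \<alpha>). sin \<theta> *\<^sub>R (partial_deriv b f (?X \<theta> \<alpha>)
      - of_real (c + 2) * (of_real (?X \<theta> \<alpha> \<bullet> b) * f (?X \<theta> \<alpha>))))"
    by (intro integral_sphere_measure continuous_intros continuous_on_polymonial_function pd f)
  ultimately have "(LINT x|sphere_measure. partial_deriv b f x - of_real (c + 2) * (of_real (x \<bullet> b) * f x)) = 0"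
    by simp
  moreover have "integrable sphere_measure (partial_deriv b f)"
    "integrable sphere_measure (\<lambda>x. of_real (x \<bullet> b) * f x)"
    by (intro integrable_sphere_measure continuous_intros continuous_on_polymonial_function pd f)+
  ultimately show ?thesis
    by simp
qed


section \<open>Spherical harmonics: orthogonality and definiteness\<close>

lemma spherical_harmonics_homogeneous:
  assumes "h \<in> spherical_harmonics n"
  shows "polynomial_function h" "homogeneous (real n) h"
  using assms by (auto simp: spherical_harmonics_def homogeneous_def powr_realpow)

text \<open>Green's identity: the field \<open>V = f \<nabla>g - g \<nabla>f\<close> is divergence free and homogeneous of degree
  \<open>m + n - 1\<close>, and by Euler's identity its radial component on the sphere is \<open>(n - m) f g\<close>. The
  divergence theorem makes the integral of the latter vanish.\<close>
lemma spherical_harmonics_orthogonal: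
  assumes f: "f \<in> spherical_harmonics m" and g: "g \<in> spherical_harmonics n" and "m \<noteq> n"
  shows "(LINT x|sphere_measure. f x * g x) = 0"
proof -
  note pf = spherical_harmonics_homogeneous(1)[OF f] and pg = spherical_harmonics_homogeneous(1)[OF g]
  note hf = spherical_harmonics_homogeneous(2)[OF f] and hg = spherical_harmonics_homogeneous(2)[OF g]
  note pdf = polynomial_function_partial_deriv[OF pf] and pdg = polynomial_function_partial_deriv[OF pg]
  define V where "V b x = f x * partial_deriv b g x - g x * partial_deriv b f x" for b x
  have pV: "polynomial_function (V b)" for b
    unfolding V_def by (intro polynomial_function_diff polynomial_function_complex_mult pf pg pdf pdg)
  have hV: "homogeneous (real m + real n - 1) (V b)" for b
  proof -
    have "homogeneous (real m + (real n - 1)) (\<lambda>x. f x * partial_deriv b g x)"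
      "homogeneous (real n + (real m - 1)) (\<lambda>x. g x * partial_deriv b f x)"
      by (intro homogeneous_mult homogeneous_partial_deriv hf hg pf pg)+
    then show ?thesis
      unfolding V_def by (intro homogeneous_diff) (simp_all add: algebra_simps)
  qed
  have dV: "partial_deriv b (V b) x = f x * partial_deriv b (partial_deriv b g) x
      - g x * partial_deriv b (partial_deriv b f) x" for b x
    unfolding V_def
    by (simp add: partial_deriv_diff partial_deriv_mult polynomial_function_complex_mult pf pg pdf pdg)
  have cV: "continuous_on A (V b)" "continuous_on A (partial_deriv b (V b))" for A b
    by (intro continuous_on_polymonial_function pV polynomial_function_partial_deriv)+
  have "(\<Sum>b\<in>Basis. partial_deriv b (V b) x) = f x * laplacian g x - g x * laplacian f x" for x
    by (simp add: dV laplacian_def sum_distrib_left sum_subtractf)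
  then have "(\<Sum>b\<in>Basis. partial_deriv b (V b) x) = 0" for x
    using f g by (simp add: spherical_harmonics_def)
  then have "0 = (LINT x|sphere_measure. (\<Sum>b\<in>Basis. partial_deriv b (V b) x))"
    by simp
  also have "\<dots> = (\<Sum>b\<in>Basis. LINT x|sphere_measure. partial_deriv b (V b) x)"
    by (intro Bochner_Integration.integral_sum integrable_sphere_measure cV)
  also have "\<dots> = of_real (real m + real n + 1) * (\<Sum>b\<in>Basis. LINT x|sphere_measure. of_real (x \<bullet> b) * V b x)"
    by (simp add: divergence_theorem_sphere[OF pV hV] sum_distrib_left add.commute)
  also have "(\<Sum>b\<in>Basis. LINT x|sphere_measure. of_real (x \<bullet> b) * V b x)
      = (LINT x|sphere_measure. (\<Sum>b\<in>Basis. of_real (x \<bullet> b) * V b x))"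
    by (intro Bochner_Integration.integral_sum[symmetric] integrable_sphere_measure continuous_intros cV)
  also have "(\<lambda>x. \<Sum>b\<in>Basis. of_real (x \<bullet> b) * V b x) = (\<lambda>x. of_real (real n - real m) * (f x * g x))"
  proof
    fix x
    have "(\<Sum>b\<in>Basis. of_real (x \<bullet> b) * V b x) = f x * partial_deriv x g x - g x * partial_deriv x f x"
      unfolding partial_deriv_basis_expansion[OF pf, of x] partial_deriv_basis_expansion[OF pg, of x] V_def
      by (simp add: sum_distrib_left sum_subtractf[symmetric] algebra_simps)
    then show "(\<Sum>b\<in>Basis. of_real (x \<bullet> b) * V b x) = of_real (real n - real m) * (f x * g x)"
      by (simp add: Euler_homogeneous[OF pf hf] Euler_homogeneous[OF pg hg] algebra_simps)
  qed
  finally have "of_real ((real m + real n + 1) * (real n - real m)) * (LINT x|sphere_measure. f x * g x) = 0"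
    by (simp add: mult.assoc)
  then show ?thesis
    using \<open>m \<noteq> n\<close> unfolding mult_eq_0_iff of_real_eq_0_iff by (auto simp: add_eq_0_iff)
qed

lemma spherical_harmonics_cnj:
  assumes "h \<in> spherical_harmonics n"
  shows "(\<lambda>x. cnj (h x)) \<in> spherical_harmonics n"
proof -
  have p: "polynomial_function h" and l: "laplacian h x = 0" for x
    using assms by (auto simp: spherical_harmonics_def)
  have "laplacian (\<lambda>x. cnj (h x)) x = cnj (laplacian h x)" for x
    using polynomial_function_partial_deriv[OF p]
    by (simp add: laplacian_def partial_deriv_cnj[OF p, abs_def] partial_deriv_cnj)
  then show ?thesis
    using assms l by (auto simp: spherical_harmonics_def polynomial_function_cnj)
qed

lemma spherical_harmonics_diff:
  assumes "g \<in> spherical_harmonics n" "h \<in> spherical_harmonics n"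
  shows "(\<lambda>x. g x - h x) \<in> spherical_harmonics n"
proof -
  have p: "polynomial_function g" "polynomial_function h"
    and l: "laplacian g x = 0" "laplacian h x = 0" for x
    using assms by (auto simp: spherical_harmonics_def)
  have "laplacian (\<lambda>x. g x - h x) x = laplacian g x - laplacian h x" for x
    using polynomial_function_partial_deriv[OF p(1)] polynomial_function_partial_deriv[OF p(2)]
    by (simp add: laplacian_def partial_deriv_diff[OF p, abs_def] partial_deriv_diff sum_subtractf)
  then show ?thesis
    using assms l by (auto simp: spherical_harmonics_def algebra_simps)
qed

lemma spherical_harmonics_zero: "(\<lambda>x. 0) \<in> spherical_harmonics n"
proof -
  have "partial_deriv b (\<lambda>x. 0) = (\<lambda>x. 0)" for b
    by (intro ext) (rule partial_deriv_eq, simp)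
  then show ?thesis
    by (simp add: spherical_harmonics_def laplacian_def)
qed

text \<open>Full support of the measure gives \<open>h = 0\<close> on the sphere, and homogeneity carries this to the
  whole space. This is what makes the projections of the spectral calculus unique.\<close>
lemma spherical_harmonics_definite:
  assumes h: "h \<in> spherical_harmonics n" and zero: "(LINT x|sphere_measure. h x * cnj (h x)) = 0"
  shows "h x = 0"
proof -
  have hom: "h (r *\<^sub>R x) = of_real (r ^ n) * h x" for r x
    using h by (simp add: spherical_harmonics_def)
  have cont: "continuous_on S2 h"
    using h by (auto simp: spherical_harmonics_def intro: continuous_on_polymonial_function)
  have "(LINT x|sphere_measure. complex_of_real ((cmod (h x))\<^sup>2)) = 0"
    using zero by (simp only: complex_norm_square)
  then have "(LINT x|sphere_measure. (cmod (h x))\<^sup>2) = 0"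
    unfolding integral_complex_of_real by simp
  moreover have "continuous_on S2 (\<lambda>x. (cmod (h x))\<^sup>2)"
    by (intro continuous_intros cont)
  ultimately have S2: "h x = 0" if "x \<in> S2" for x
    using sphere_measure_full_support[of "\<lambda>x. (cmod (h x))\<^sup>2" x] that by auto
  have nz: "h x = 0" if "x \<noteq> 0" for x
  proof -
    have "h (x /\<^sub>R norm x) = 0"
      using that by (intro S2) simp
    then show ?thesis
      using hom[of "norm x" "x /\<^sub>R norm x"] that by simp
  qed
  have "h 0 = of_real (0 ^ n) * h (axis 1 1)"
    using hom[of 0 "axis 1 1"] by simp
  then show ?thesis
    using nz[of x] nz[of "axis 1 1"] by (cases "x = 0") (auto simp: axis_eq_0_iff)
qed


section \<open>Spectral calculus on finite sums of spherical harmonics\<close>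

lemma continuous_on_spherical_harmonic:
  assumes "h \<in> spherical_harmonics n"
  shows "continuous_on A h"
  by (intro continuous_on_polymonial_function spherical_harmonics_homogeneous(1)[OF assms])

lemma harmonic_proj_sum:
  assumes A: "finite A" and h: "\<And>k. k \<in> A \<Longrightarrow> h k \<in> spherical_harmonics k"
  shows "harmonic_proj n (\<lambda>x. \<Sum>k\<in>A. h k x) = (\<lambda>x. if n \<in> A then h n x else 0)"
  unfolding harmonic_proj_def
proof (rule the_equality)
  let ?\<phi> = "\<lambda>x. \<Sum>k\<in>A. h k x" and ?h = "\<lambda>x. if n \<in> A then h n x else 0"
  note cont = continuous_on_spherical_harmonic
  have cont\<phi>: "continuous_on S2 ?\<phi>"
    by (intro continuous_intros) (rule cont[OF h])
  have hn: "?h \<in> spherical_harmonics n"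
    using h by (cases "n \<in> A") (auto intro: spherical_harmonics_zero)
  have orth: "(LINT x|sphere_measure. (?\<phi> x - ?h x) * cnj (k x)) = 0"
    if k: "k \<in> spherical_harmonics n" for k
  proof -
    have "?\<phi> x - ?h x = (\<Sum>j\<in>A - {n}. h j x)" for x
      using A by (simp add: sum_diff1)
    then have "(LINT x|sphere_measure. (?\<phi> x - ?h x) * cnj (k x))
        = (LINT x|sphere_measure. (\<Sum>j\<in>A - {n}. h j x * cnj (k x)))"
      by (simp only: sum_distrib_right)
    also have "\<dots> = (\<Sum>j\<in>A - {n}. LINT x|sphere_measure. h j x * cnj (k x))"
      by (intro Bochner_Integration.integral_sum integrable_sphere_measure continuous_intros)
        (auto intro: cont[OF h] cont[OF k])
    also have "\<dots> = 0"
      by (intro sum.neutral ballI spherical_harmonics_orthogonal[OF h spherical_harmonics_cnj[OF k]]) auto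
    finally show ?thesis .
  qed
  show "?h \<in> spherical_harmonics n \<and>
      (\<forall>k\<in>spherical_harmonics n. (LINT x|sphere_measure. (?\<phi> x - ?h x) * cnj (k x)) = 0)"
    using hn orth by blast
  fix g
  assume g: "g \<in> spherical_harmonics n \<and>
      (\<forall>k\<in>spherical_harmonics n. (LINT x|sphere_measure. (?\<phi> x - g x) * cnj (k x)) = 0)"
  \<comment> \<open>Two candidates differ by a spherical harmonic that is orthogonal to itself.\<close>
  let ?d = "\<lambda>x. g x - ?h x"
  have d: "?d \<in> spherical_harmonics n"
    using g hn by (intro spherical_harmonics_diff) auto
  have "(LINT x|sphere_measure. (?\<phi> x - ?h x) * cnj (?d x) - (?\<phi> x - g x) * cnj (?d x)) = 0"
    using orth[OF d] g d
    by (subst Bochner_Integration.integral_diff)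
      (auto intro!: integrable_sphere_measure continuous_intros cont\<phi> cont[OF hn] cont[of g n] cont[OF d])
  then have "(LINT x|sphere_measure. ?d x * cnj (?d x)) = 0"
    by (simp only: left_diff_distrib[symmetric] diff_diff_eq2 add_diff_cancel_left' diff_add_cancel)
      (simp add: algebra_simps)
  from spherical_harmonics_definite[OF d this] show "g = ?h"
    by (simp add: fun_eq_iff)
qed

lemma fun_of_neg_laplace_sum:
  assumes "finite A" and "\<And>k. k \<in> A \<Longrightarrow> h k \<in> spherical_harmonics k"
  shows "fun_of_neg_laplace F (\<lambda>x. \<Sum>k\<in>A. h k x) x
    = (\<Sum>k\<in>A. F (real k * (real k + 1)) * h k x)"
proof -
  have "harmonic_proj n (\<lambda>x. \<Sum>k\<in>A. h k x) x = (if n \<in> A then h n x else 0)" for n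
    using harmonic_proj_sum[of A h n] assms by simp
  then show ?thesis
    unfolding fun_of_neg_laplace_def using assms(1) by (subst suminf_finite[of A]) auto
qed

lemma Parseval_sphere:
  assumes A: "finite A" and h: "\<And>k. k \<in> A \<Longrightarrow> h k \<in> spherical_harmonics k"
  shows "(LINT x|sphere_measure. (cmod (\<Sum>k\<in>A. of_real (c k) * h k x))\<^sup>2)
    = (\<Sum>k\<in>A. (c k)\<^sup>2 * (LINT x|sphere_measure. (cmod (h k x))\<^sup>2))"
proof -
  note cont = continuous_on_spherical_harmonic[OF h]
  have "complex_of_real (LINT x|sphere_measure. (cmod (\<Sum>k\<in>A. of_real (c k) * h k x))\<^sup>2)
    = (LINT x|sphere_measure. (\<Sum>k\<in>A. \<Sum>j\<in>A. of_real (c k * c j) * (h k x * cnj (h j x))))"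
    unfolding integral_complex_of_real[symmetric] complex_norm_square
    by (simp add: sum_product mult_ac)
  also have "\<dots> = (\<Sum>k\<in>A. LINT x|sphere_measure. (\<Sum>j\<in>A. of_real (c k * c j) * (h k x * cnj (h j x))))"
    by (intro Bochner_Integration.integral_sum integrable_sphere_measure continuous_intros cont)
  also have "\<dots> = (\<Sum>k\<in>A. \<Sum>j\<in>A. LINT x|sphere_measure. of_real (c k * c j) * (h k x * cnj (h j x)))"
    by (intro sum.cong refl Bochner_Integration.integral_sum integrable_sphere_measure continuous_intros cont)
  also have "\<dots> = (\<Sum>k\<in>A. \<Sum>j\<in>A. of_real (c k * c j) * (LINT x|sphere_measure. h k x * cnj (h j x)))"
    by simp
  also have "\<dots> = (\<Sum>k\<in>A. \<Sum>j\<in>A. if j = k then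
      of_real ((c k)\<^sup>2 * (LINT x|sphere_measure. (cmod (h k x))\<^sup>2)) else 0)"
  proof (intro sum.cong refl)
    fix k j assume "k \<in> A" "j \<in> A"
    then show "of_real (c k * c j) * (LINT x|sphere_measure. h k x * cnj (h j x)) = (if j = k then
      of_real ((c k)\<^sup>2 * (LINT x|sphere_measure. (cmod (h k x))\<^sup>2)) else 0)"
      using spherical_harmonics_orthogonal[OF h spherical_harmonics_cnj[OF h], of k j]
      by (auto simp: power2_eq_square simp flip: integral_complex_of_real complex_norm_square)
  qed
  also have "\<dots> = of_real (\<Sum>k\<in>A. (c k)\<^sup>2 * (LINT x|sphere_measure. (cmod (h k x))\<^sup>2))"
    using A by simp
  finally show ?thesis
    by (simp only: of_real_eq_iff)
qed

lemma sobolev_norm_sum: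
  assumes A: "finite A" and h: "\<And>k. k \<in> A \<Longrightarrow> h k \<in> spherical_harmonics k"
  shows "sobolev_norm s (\<lambda>x. \<Sum>k\<in>A. h k x)
    = sqrt (\<Sum>k\<in>A. (1 + real k * (real k + 1)) powr s * (LINT x|sphere_measure. (cmod (h k x))\<^sup>2))"
proof -
  have pow: "((1 + real k * (real k + 1)) powr (s / 2))\<^sup>2 = (1 + real k * (real k + 1)) powr s" for k
    by (simp add: power2_eq_square flip: powr_add)
  have F: "fun_of_neg_laplace F (\<lambda>x. \<Sum>k\<in>A. h k x) = (\<lambda>x. \<Sum>k\<in>A. F (real k * (real k + 1)) * h k x)" for F
    using fun_of_neg_laplace_sum[of A h F] assms by auto
  have "sobolev_norm s (\<lambda>x. \<Sum>k\<in>A. h k x) = sqrt (LINT x|sphere_measure.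
      (cmod (\<Sum>k\<in>A. of_real ((1 + real k * (real k + 1)) powr (s / 2)) * h k x))\<^sup>2)"
    unfolding sobolev_norm_def Lp_norm_def F by (simp add: powr_half_sqrt)
  then show ?thesis
    using Parseval_sphere[of A h] assms by (simp only: pow)
qed


section \<open>Maximal functions\<close>

lemma bdd_above_norm_unimodular_sum:
  fixes c :: "'t \<Rightarrow> 'k \<Rightarrow> complex"
  assumes "\<And>t k. cmod (c t k) \<le> 1"
  shows "bdd_above ((\<lambda>t. cmod (\<Sum>k\<in>A. c t k * h k)) ` T)"
proof (rule bdd_aboveI2)
  show "cmod (\<Sum>k\<in>A. c t k * h k) \<le> (\<Sum>k\<in>A. cmod (h k))" for t
    using assms by (intro sum_norm_le) (simp add: norm_mult mult_left_le_one_le)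
qed

text \<open>The differences of the functions at two points are bounded uniformly in \<open>t\<close>, so the family is
  equicontinuous and its supremum inherits the modulus of continuity. In particular
  the maximal function is integrable to every power.\<close>
lemma continuous_on_maximal_function:
  fixes c :: "'t \<Rightarrow> 'k \<Rightarrow> complex" and h :: "'k \<Rightarrow> 'a::metric_space \<Rightarrow> complex"
  assumes c: "\<And>t k. cmod (c t k) \<le> 1" and h: "\<And>k. k \<in> A \<Longrightarrow> continuous_on S (h k)" and T: "T \<noteq> {}"
  shows "continuous_on S (\<lambda>x. SUP t\<in>T. cmod (\<Sum>k\<in>A. c t k * h k x))"
proof -
  let ?u = "\<lambda>t x. \<Sum>k\<in>A. c t k * h k x"
  let ?G = "\<lambda>x. SUP t\<in>T. cmod (?u t x)" and ?D = "\<lambda>x y. \<Sum>k\<in>A. cmod (h k y - h k x)"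
  have le: "?G y \<le> ?G x + ?D x y" for x y
  proof (rule cSUP_least[OF T])
    fix t assume "t \<in> T"
    have "cmod (?u t y) = cmod (?u t x + (\<Sum>k\<in>A. c t k * (h k y - h k x)))"
      by (simp add: sum.distrib[symmetric] algebra_simps)
    also have "\<dots> \<le> cmod (?u t x) + cmod (\<Sum>k\<in>A. c t k * (h k y - h k x))"
      by (rule norm_triangle_ineq)
    also have "cmod (\<Sum>k\<in>A. c t k * (h k y - h k x)) \<le> ?D x y"
      using c by (intro sum_norm_le) (simp add: norm_mult mult_left_le_one_le)
    also have "cmod (?u t x) \<le> ?G x"
      by (intro cSUP_upper \<open>t \<in> T\<close> bdd_above_norm_unimodular_sum c)
    finally show "cmod (?u t y) \<le> ?G x + ?D x y" by simp
  qed
  have diff: "norm (?G y - ?G x) \<le> ?D x y" for x y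
    using le[of x y] le[of y x] by (simp add: norm_minus_commute abs_le_iff)
  show ?thesis
    unfolding continuous_on_def
  proof
    fix x assume "x \<in> S"
    then have "(?D x \<longlongrightarrow> (\<Sum>k\<in>A. cmod (h k x - h k x))) (at x within S)"
      using h by (intro tendsto_intros) (auto simp: continuous_on_def)
    then have D: "(?D x \<longlongrightarrow> 0) (at x within S)"
      by simp
    have "((\<lambda>y. ?G y - ?G x) \<longlongrightarrow> 0) (at x within S)"
      by (rule Lim_null_comparison[OF always_eventually D]) (intro allI diff)
    then show "(?G \<longlongrightarrow> ?G x) (at x within S)"
      by (rule LIM_zero_cancel)
  qed
qed

lemma Lp_norm_mono:
  assumes f: "continuous_on S2 f" and g: "continuous_on S2 (g :: real ^ 3 \<Rightarrow> real)" and p: "0 < p"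
    and le: "\<And>x. x \<in> S2 \<Longrightarrow> 0 \<le> f x \<and> f x \<le> g x powr p"
    and nonneg: "\<And>x. x \<in> S2 \<Longrightarrow> 0 \<le> g x"
  shows "(LINT x|sphere_measure. f x) powr (1 / p) \<le> Lp_norm p g"
proof -
  have "(LINT x|sphere_measure. f x) \<le> (LINT x|sphere_measure. norm (g x) powr p)"
    using p le nonneg
    by (intro integral_mono integrable_sphere_measure f continuous_on_powr' continuous_intros g) auto
  moreover have "0 \<le> (LINT x|sphere_measure. f x)"
    using le by (intro integral_nonneg_AE AE_I2) auto
  ultimately show ?thesis
    unfolding Lp_norm_def using p by (intro powr_mono2) auto
qed


section \<open>Highest weight spherical harmonics\<close>

definition horizontal :: "real ^ 3 \<Rightarrow> complex" where
  "horizontal x = Complex (x $ 1) (x $ 2)"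

abbreviation highest_weight :: "nat \<Rightarrow> real ^ 3 \<Rightarrow> complex" where
  "highest_weight n x \<equiv> horizontal x ^ n"

lemma bounded_linear_horizontal: "bounded_linear horizontal"
  unfolding horizontal_def Complex_eq
  by (intro bounded_linear_add bounded_linear_compose[OF bounded_linear_mult_right]
      bounded_linear_compose[OF bounded_linear_of_real] bounded_linear_vec_nth)

lemma horizontal_axis [simp]:
  "horizontal (axis 1 1) = 1" "horizontal (axis 2 1) = \<i>" "horizontal (axis 3 1) = 0"
  by (simp_all add: horizontal_def axis_def complex_eq_iff)

lemma norm_horizontal_le: "cmod (horizontal x) \<le> norm x"
  unfolding horizontal_def cmod_def norm_vec_def L2_set_def sum_3 by (simp add: power2_eq_square)

lemma polynomial_function_highest_weight: "polynomial_function (highest_weight n)"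
  by (intro polynomial_function_complex_power polynomial_function_bounded_linear bounded_linear_horizontal)

lemma partial_deriv_highest_weight:
  "partial_deriv b (\<lambda>x. a * highest_weight n x) = (\<lambda>x. a * of_nat n * horizontal b * highest_weight (n - 1) x)"
proof
  fix x
  show "partial_deriv b (\<lambda>x. a * highest_weight n x) x
    = a * of_nat n * horizontal b * highest_weight (n - 1) x"
    by (rule partial_deriv_eq)
      (auto intro!: derivative_eq_intros bounded_linear_imp_has_derivative bounded_linear_horizontal
        simp: mult_ac)
qed

lemma sum_Basis_3: "(\<Sum>b\<in>Basis. F (b :: real ^ 3)) = F (axis 1 1) + F (axis 2 1) + F (axis 3 1)"
proof -
  have B: "(Basis :: (real ^ 3) set) = range (\<lambda>i. axis i 1)"
    by (auto simp: Basis_vec_def)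
  have "inj (\<lambda>i::3. axis i (1::real))"
    by (auto simp: inj_def axis_eq_axis)
  then show ?thesis
    unfolding B by (subst sum.reindex) (simp_all add: sum_3)
qed

lemma highest_weight_spherical_harmonics: "highest_weight n \<in> spherical_harmonics n"
proof -
  have 1: "partial_deriv b (highest_weight n) = (\<lambda>x. of_nat n * horizontal b * highest_weight (n - 1) x)" for b
    using partial_deriv_highest_weight[of b 1 n] by simp
  have "laplacian (highest_weight n) x
      = of_nat n * of_nat (n - 1) * highest_weight (n - 1 - 1) x * (\<Sum>b\<in>Basis. (horizontal b)\<^sup>2)" for x
    unfolding laplacian_def 1 partial_deriv_highest_weight sum_distrib_left
    by (simp add: power2_eq_square mult_ac)
  then have "laplacian (highest_weight n) x = 0" for x
    by (simp add: sum_Basis_3)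
  moreover have "horizontal (r *\<^sub>R x) = of_real r * horizontal x" for r x
    by (simp add: horizontal_def complex_eq_iff)
  ultimately show ?thesis
    by (simp add: spherical_harmonics_def polynomial_function_highest_weight power_mult_distrib)
qed

text \<open>The squared \<open>L\<^sup>2\<close> norm of the highest weight harmonic of degree \<open>n\<close>, written as the
  integral of an even power of \<open>\<rho>\<close> because it also serves to bound \<open>L\<^sup>p\<close> norms.\<close>
definition highest_weight_mass :: "nat \<Rightarrow> real" where
  "highest_weight_mass n = (LINT x|sphere_measure. (cmod (horizontal x))\<^sup>2 ^ n)"

text \<open>With \<open>z = x\<^sub>1 + \<i> x\<^sub>2\<close>, the operator \<open>\<partial>\<^sub>1 + \<i> \<partial>\<^sub>2\<close> annihilates \<open>z\<close> and sends the conjugate of \<open>z\<close>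
  to \<open>2\<close>. The recursion is the divergence theorem for this operator applied to \<open>z\<^sup>n\<close> times the
  conjugate of \<open>z\<^sup>n\<^sup>+\<^sup>1\<close>, a function homogeneous of degree \<open>2 n + 1\<close>.\<close>
lemma highest_weight_mass_Suc:
  "(2 * real n + 3) * highest_weight_mass (Suc n) = (2 * real n + 2) * highest_weight_mass n"
proof -
  let ?f = "\<lambda>x. highest_weight n x * cnj (highest_weight (Suc n) x)"
  note pf = polynomial_function_complex_mult[OF polynomial_function_highest_weight
      polynomial_function_cnj[OF polynomial_function_highest_weight], of n "Suc n"]
  have hom: "homogeneous (2 * real n + 1) ?f"
    using homogeneous_mult[OF spherical_harmonics_homogeneous(2)[OF highest_weight_spherical_harmonics]
        spherical_harmonics_homogeneous(2)[OF spherical_harmonics_cnj[OF highest_weight_spherical_harmonics]], of n "Suc n"]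
    by (simp add: algebra_simps)
  have pd: "partial_deriv b (highest_weight m) x = of_nat m * horizontal b * highest_weight (m - 1) x" for b m x
    using partial_deriv_highest_weight[of b 1 m] by simp
  have mass: "complex_of_real (highest_weight_mass m) = (LINT x|sphere_measure. highest_weight m x * cnj (highest_weight m x))" for m
    unfolding highest_weight_mass_def integral_complex_of_real[symmetric] of_real_power[of _ m]
      complex_norm_square by (simp add: power_mult_distrib)
  let ?D = "\<lambda>x. partial_deriv (axis 1 1) ?f x + \<i> * partial_deriv (axis 2 1) ?f x"
  have D: "?D x = of_real (2 * real n + 2) * (highest_weight n x * cnj (highest_weight n x))" for x
    unfolding partial_deriv_mult[OF polynomial_function_highest_weight
      polynomial_function_cnj[OF polynomial_function_highest_weight]]
      partial_deriv_cnj[OF polynomial_function_highest_weight] pd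
    by (simp add: algebra_simps)
  define g where "g b x = of_real (x \<bullet> b) * ?f x" for b x
  have int: "integrable sphere_measure (partial_deriv b ?f)" "integrable sphere_measure (g b)" for b
    unfolding g_def by (intro integrable_sphere_measure continuous_intros continuous_on_polymonial_function pf
        polynomial_function_partial_deriv)+
  have "of_real (2 * real n + 2) * complex_of_real (highest_weight_mass n) = (LINT x|sphere_measure. ?D x)"
    unfolding D mass by simp
  also have "\<dots> = (LINT x|sphere_measure. partial_deriv (axis 1 1) ?f x)
      + \<i> * (LINT x|sphere_measure. partial_deriv (axis 2 1) ?f x)"
    using int(1) by simp
  also have "\<dots> = of_real (2 * real n + 3) * (LINT x|sphere_measure.
      g (axis 1 1) x + \<i> * g (axis 2 1) x)"
    unfolding divergence_theorem_sphere[OF pf hom] g_def[symmetric] using int(2)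
    by (simp add: distrib_left mult.left_commute add.commute)
  also have "(\<lambda>x. g (axis 1 1) x + \<i> * g (axis 2 1) x)
      = (\<lambda>x. highest_weight (Suc n) x * cnj (highest_weight (Suc n) x))"
  proof
    fix x
    have "horizontal x = of_real (x \<bullet> axis 1 1) + \<i> * of_real (x \<bullet> axis 2 1)"
      by (simp add: horizontal_def Complex_eq inner_axis)
    then show "g (axis 1 1) x + \<i> * g (axis 2 1) x
      = highest_weight (Suc n) x * cnj (highest_weight (Suc n) x)"
      by (simp add: g_def algebra_simps)
  qed
  finally have "complex_of_real ((2 * real n + 2) * highest_weight_mass n)
      = of_real ((2 * real n + 3) * highest_weight_mass (Suc n))"
    unfolding mass[symmetric] of_real_mult .
  then show ?thesis
    by (simp only: of_real_eq_iff)
qed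

lemma highest_weight_mass_0_pos: "0 < highest_weight_mass 0"
proof -
  have "0 \<le> highest_weight_mass 0"
    unfolding highest_weight_mass_def by (intro integral_nonneg_AE AE_I2) auto
  moreover have "highest_weight_mass 0 \<noteq> 0"
    using sphere_measure_full_support[of "\<lambda>x. 1" "axis 1 1"] by (auto simp: highest_weight_mass_def)
  ultimately show ?thesis by simp
qed

text \<open>Both bounds follow from the recursion as for the Wallis product: the factor
  \<open>(2 n + 2) / (2 n + 3)\<close> lies between \<open>sqrt ((2 n + 1) / (2 n + 3))\<close> and \<open>sqrt ((n + 1) / (n + 2))\<close>.
  They say that the mass of \<open>\<bar>z\<^sup>n\<bar>\<^sup>2\<close> is of order \<open>n\<^sup>-\<^sup>1\<^sup>/\<^sup>2\<close>, the width of the strip around the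
  equator where it concentrates.\<close>
lemma highest_weight_mass_bounds:
  "highest_weight_mass 0 / sqrt (2 * real n + 1) \<le> highest_weight_mass n"
  "highest_weight_mass n \<le> highest_weight_mass 0 / sqrt (real n + 1)"
proof -
  have step: "highest_weight_mass (Suc n) = (2 * real n + 2) / (2 * real n + 3) * highest_weight_mass n" for n
    using highest_weight_mass_Suc[of n] by (simp add: field_simps)
  show "highest_weight_mass 0 / sqrt (2 * real n + 1) \<le> highest_weight_mass n"
  proof (induction n)
    case (Suc n)
    have "1 / sqrt (2 * real n + 3) \<le> (2 * real n + 2) / (2 * real n + 3) * (1 / sqrt (2 * real n + 1))"
    proof (rule power2_le_imp_le)
      show "(1 / sqrt (2 * real n + 3))\<^sup>2 \<le> ((2 * real n + 2) / (2 * real n + 3) * (1 / sqrt (2 * real n + 1)))\<^sup>2"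
        by (simp add: power_mult_distrib power_divide divide_simps) (simp add: power2_eq_square algebra_simps)
    qed simp
    then have "highest_weight_mass 0 * (1 / sqrt (2 * real n + 3))
        \<le> highest_weight_mass 0 * ((2 * real n + 2) / (2 * real n + 3) * (1 / sqrt (2 * real n + 1)))"
      using highest_weight_mass_0_pos by (intro mult_left_mono) auto
    also have "\<dots> = (2 * real n + 2) / (2 * real n + 3) * (highest_weight_mass 0 / sqrt (2 * real n + 1))"
      by simp
    also have "\<dots> \<le> (2 * real n + 2) / (2 * real n + 3) * highest_weight_mass n"
      by (intro mult_left_mono Suc.IH) auto
    finally show ?case
      by (simp add: step add.commute)
  qed simp
  show "highest_weight_mass n \<le> highest_weight_mass 0 / sqrt (real n + 1)"
  proof (induction n)
    case (Suc n)
    have "(2 * real n + 2) / (2 * real n + 3) * (1 / sqrt (real n + 1)) \<le> 1 / sqrt (real n + 2)"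
    proof (rule power2_le_imp_le)
      show "((2 * real n + 2) / (2 * real n + 3) * (1 / sqrt (real n + 1)))\<^sup>2 \<le> (1 / sqrt (real n + 2))\<^sup>2"
        by (simp add: power_mult_distrib power_divide divide_simps) (simp add: power2_eq_square algebra_simps)
    qed simp
    then have "highest_weight_mass 0 * ((2 * real n + 2) / (2 * real n + 3) * (1 / sqrt (real n + 1)))
        \<le> highest_weight_mass 0 * (1 / sqrt (real n + 2))"
      using highest_weight_mass_0_pos by (intro mult_left_mono) auto
    moreover have "(2 * real n + 2) / (2 * real n + 3) * highest_weight_mass n
        \<le> (2 * real n + 2) / (2 * real n + 3) * (highest_weight_mass 0 / sqrt (real n + 1))"
      by (intro mult_left_mono Suc.IH) auto
    ultimately have "highest_weight_mass (Suc n) \<le> highest_weight_mass 0 / sqrt (real n + 2)"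
      unfolding step by (simp only: times_divide_eq_right times_divide_eq_left mult_1_right mult.commute)
    then show ?case
      by (simp add: add.commute)
  qed simp
qed


section \<open>The counterexample\<close>

text \<open>The band of degrees starts at \<open>N = 4 m\<^sup>2\<close> and has length about \<open>sqrt N / 2\<close>. Over a time of order
  \<open>1 / N\<close>, in which the packet travels once around the equator, the second-order phases in the
  band stay bounded, so the packet does not disperse.\<close>
definition wave_packet :: "nat \<Rightarrow> real ^ 3 \<Rightarrow> complex" where
  "wave_packet m x = (\<Sum>n\<in>{4 * m\<^sup>2..4 * m\<^sup>2 + m}. highest_weight n x)"

lemma polynomial_function_wave_packet: "polynomial_function (wave_packet m)"
  unfolding wave_packet_def[abs_def] by (intro polynomial_function_sum polynomial_function_highest_weight) auto

lemma schroedinger_wave_packet: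
  "schroedinger t (wave_packet m) x
    = (\<Sum>n\<in>{4 * m\<^sup>2..4 * m\<^sup>2 + m}. exp (- \<i> * of_real (t * (real n * (real n + 1)))) * highest_weight n x)"
  unfolding schroedinger_def wave_packet_def[abs_def]
  by (intro fun_of_neg_laplace_sum highest_weight_spherical_harmonics) auto

text \<open>At a point of longitude \<open>\<alpha>\<close> the time \<open>t = \<alpha> / (2 N + 1)\<close> is chosen. For \<open>n = N + k\<close> one has
  \<open>n (n + 1) = N (N + 1) + k (2 N + 1) + k\<^sup>2\<close>, so that the phase \<open>n \<alpha> - t n (n + 1)\<close> equals
  \<open>- t k\<^sup>2\<close> up to a term independent of \<open>k\<close>: the linear terms cancel. As \<open>t k\<^sup>2\<close> is at most
  \<open>2 pi m\<^sup>2 / (8 m\<^sup>2 + 1) < pi / 3\<close>, all terms then have real part at least half their modulus, up to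
  the common phase.\<close>
lemma maximal_function_lower_bound:
  fixes m :: nat
  assumes x: "x \<in> S2"
  shows "real m / 2 * cmod (horizontal x) ^ (4 * m\<^sup>2 + m)
    \<le> (SUP t\<in>{0..2 * pi}. cmod (schroedinger t (wave_packet m) x))"
proof -
  define N \<rho> \<alpha> where "N = 4 * m\<^sup>2" and "\<rho> = cmod (horizontal x)" and "\<alpha> = Arg2pi (horizontal x)"
  define t where "t = \<alpha> / (2 * real N + 1)"
  have \<rho>: "0 \<le> \<rho>" "\<rho> \<le> 1"
    using norm_horizontal_le[of x] x by (auto simp: \<rho>_def)
  have \<alpha>: "0 \<le> \<alpha>" "\<alpha> < 2 * pi" and polar: "horizontal x = of_real \<rho> * exp (\<i> * of_real \<alpha>)"
    using Arg2pi[of "horizontal x"] by (auto simp: \<alpha>_def \<rho>_def is_Arg_def)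
  have "\<alpha> * 1 \<le> 2 * pi * (2 * real N + 1)"
    using \<alpha> by (intro mult_mono) auto
  then have t: "t \<in> {0..2 * pi}"
    using \<alpha> by (simp add: t_def divide_le_eq)
  have angle: "0 \<le> t * (real k)\<^sup>2" "t * (real k)\<^sup>2 \<le> pi / 3" if "k \<le> m" for k
  proof -
    show "0 \<le> t * (real k)\<^sup>2"
      using t by simp
    have "(real k)\<^sup>2 \<le> (real m)\<^sup>2"
      using that by (intro power_mono) auto
    then have "\<alpha> * (real k)\<^sup>2 \<le> 2 * pi * (real m)\<^sup>2"
      using \<alpha> by (intro mult_mono) auto
    also have "\<dots> = pi * (2 * (real m)\<^sup>2)"
      by simp
    also have "\<dots> \<le> pi * ((2 * real N + 1) / 3)"
      by (intro mult_left_mono) (auto simp: N_def)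
    also have "\<dots> = pi / 3 * (2 * real N + 1)"
      by simp
    finally show "t * (real k)\<^sup>2 \<le> pi / 3"
      by (simp add: t_def divide_le_eq)
  qed
  define \<gamma> where "\<gamma> = real N * \<alpha> - t * (real N * (real N + 1))"
  have mode: "exp (- \<i> * of_real (t * (real (N + k) * (real (N + k) + 1)))) * highest_weight (N + k) x
      = exp (\<i> * of_real \<gamma>) * (of_real (\<rho> ^ (N + k)) * exp (- \<i> * of_real (t * (real k)\<^sup>2)))" for k
  proof -
    have \<alpha>_eq: "\<alpha> = t * (2 * real N + 1)"
      by (simp add: t_def add_eq_0_iff)
    have "real (N + k) * \<alpha> - t * (real (N + k) * (real (N + k) + 1)) = \<gamma> - t * (real k)\<^sup>2"
      unfolding \<gamma>_def \<alpha>_eq by (simp add: power2_eq_square algebra_simps)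
    then have phase: "- (\<i> * of_real (t * (real (N + k) * (real (N + k) + 1)))) + of_nat (N + k) * (\<i> * of_real \<alpha>)
        = \<i> * of_real \<gamma> + - (\<i> * of_real (t * (real k)\<^sup>2))"
      by (simp add: complex_eq_iff)
    show ?thesis
      unfolding polar power_mult_distrib exp_of_nat_mult[symmetric]
      using phase by (simp add: exp_add[symmetric] mult.left_commute del: of_real_mult of_real_add of_nat_add)
  qed
  have "real m / 2 * \<rho> ^ (N + m) \<le> (\<Sum>k\<le>m. \<rho> ^ (N + m) * (1 / 2))"
    using \<rho> by (simp add: algebra_simps)
  also have "\<dots> \<le> (\<Sum>k\<le>m. \<rho> ^ (N + k) * cos (t * (real k)\<^sup>2))"
  proof (intro sum_mono mult_mono)
    fix k assume "k \<in> {..m}"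
    then have "cos (pi / 3) \<le> cos (t * (real k)\<^sup>2)"
      using angle[of k] by (intro cos_monotone_0_pi_le) auto
    then show "1 / 2 \<le> cos (t * (real k)\<^sup>2)"
      by (simp add: cos_60)
    show "\<rho> ^ (N + m) \<le> \<rho> ^ (N + k)"
      using \<rho> \<open>k \<in> {..m}\<close> by (intro power_decreasing) auto
  qed (use \<rho> in auto)
  also have "\<dots> = Re (\<Sum>k\<le>m. of_real (\<rho> ^ (N + k)) * exp (- \<i> * of_real (t * (real k)\<^sup>2)))"
    by (simp add: Re_exp del: of_real_power of_real_mult)
  also have "\<dots> \<le> cmod (\<Sum>k\<le>m. of_real (\<rho> ^ (N + k)) * exp (- \<i> * of_real (t * (real k)\<^sup>2)))"
    by (rule complex_Re_le_cmod)
  also have "\<dots> = cmod (exp (\<i> * of_real \<gamma>) * (\<Sum>k\<le>m. of_real (\<rho> ^ (N + k)) * exp (- \<i> * of_real (t * (real k)\<^sup>2))))"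
    by (simp add: norm_mult)
  also have "\<dots> = cmod (\<Sum>k\<le>m. exp (- \<i> * of_real (t * (real (N + k) * (real (N + k) + 1)))) * highest_weight (N + k) x)"
    by (simp only: mode sum_distrib_left)
  also have "(\<Sum>k\<le>m. exp (- \<i> * of_real (t * (real (N + k) * (real (N + k) + 1)))) * highest_weight (N + k) x)
      = schroedinger t (wave_packet m) x"
    unfolding schroedinger_wave_packet N_def[symmetric]
    by (rule sum.reindex_bij_witness[of _ "\<lambda>n. n - N" "\<lambda>k. N + k"]) auto
  also have "cmod \<dots> \<le> (SUP t\<in>{0..2 * pi}. cmod (schroedinger t (wave_packet m) x))"
    unfolding schroedinger_wave_packet by (intro cSUP_upper t bdd_above_norm_unimodular_sum) simp
  finally show ?thesis
    by (simp add: N_def \<rho>_def)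
qed

text \<open>The pointwise bound is of order \<open>m\<close> on the strip of width of order \<open>1 / m\<close> around the equator,
  which explains the power \<open>1 - 1 / p\<close>. The integral of the \<open>p\<close>-th power is estimated by the mass of
  a highest weight harmonic of degree \<open>L\<close> with \<open>2 L\<close> at least \<open>p (4 m\<^sup>2 + m)\<close>.\<close>
lemma maximal_function_Lp_lower_bound:
  assumes p: "2 \<le> p"
  shows "\<exists>c>0. \<forall>m\<ge>1. c * real m powr (1 - 1 / p)
    \<le> Lp_norm p (\<lambda>x. SUP t\<in>{0..2 * pi}. cmod (schroedinger t (wave_packet m) x))"
proof (intro exI conjI allI impI)
  \<comment> \<open>As \<open>4 m\<^sup>2 + m \<le> 5 m\<^sup>2\<close>, the degree \<open>L = q m\<^sup>2\<close> below satisfies \<open>2 L \<ge> p (4 m\<^sup>2 + m)\<close>.\<close>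
  define q where "q = nat \<lceil>5 * p / 2\<rceil>"
  have q: "5 * p / 2 \<le> real q" "1 \<le> q"
    using p unfolding q_def by linarith+
  define c where "c = (highest_weight_mass 0 / sqrt (3 * real q)) powr (1 / p) / 2"
  show "c > 0"
    using highest_weight_mass_0_pos q by (simp add: c_def)
  fix m :: nat
  assume m: "1 \<le> m"
  define L where "L = q * m\<^sup>2"
  have L: "1 \<le> L" "p * real (4 * m\<^sup>2 + m) \<le> 2 * real L"
  proof -
    show "1 \<le> L"
      using m q by (simp add: L_def)
    have "p * real (4 * m\<^sup>2 + m) \<le> p * (5 * (real m)\<^sup>2)"
      using m p by (intro mult_left_mono) (auto simp: power2_eq_square)
    also have "\<dots> = 2 * (5 * p / 2 * (real m)\<^sup>2)"
      by simp
    also have "\<dots> \<le> 2 * (real q * (real m)\<^sup>2)"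
      using q by (intro mult_left_mono mult_right_mono) auto
    finally show "p * real (4 * m\<^sup>2 + m) \<le> 2 * real L"
      by (simp add: L_def)
  qed
  let ?G = "\<lambda>x. SUP t\<in>{0..2 * pi}. cmod (schroedinger t (wave_packet m) x)"
  let ?f = "\<lambda>x. (real m / 2) powr p * (cmod (horizontal x))\<^sup>2 ^ L"
  have cont: "continuous_on S horizontal" for S
    using bounded_linear_horizontal by (rule linear_continuous_on)
  have G: "continuous_on S2 ?G"
    unfolding schroedinger_wave_packet
    by (intro continuous_on_maximal_function continuous_intros cont) auto
  have "?f x \<le> ?G x powr p" if x: "x \<in> S2" for x
  proof -
    have \<rho>: "0 \<le> cmod (horizontal x)" "cmod (horizontal x) \<le> 1"
      using norm_horizontal_le[of x] x by auto
    have "(cmod (horizontal x))\<^sup>2 ^ L \<le> (cmod (horizontal x) ^ (4 * m\<^sup>2 + m)) powr p"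
    proof (cases "cmod (horizontal x) = 0")
      case True
      then show ?thesis
        using L(1) by (simp add: power_0_left)
    next
      case False
      then have pos: "0 < cmod (horizontal x)"
        using \<rho> by simp
      have "(cmod (horizontal x))\<^sup>2 ^ L = cmod (horizontal x) powr (2 * real L)"
        using powr_realpow[OF pos, of "2 * L"] by (simp add: power_mult)
      also have "\<dots> \<le> cmod (horizontal x) powr (p * real (4 * m\<^sup>2 + m))"
        using L(2) pos \<rho> by (intro powr_mono') auto
      also have "\<dots> = (cmod (horizontal x) ^ (4 * m\<^sup>2 + m)) powr p"
        using powr_realpow[OF pos, of "4 * m\<^sup>2 + m"] by (metis powr_powr mult.commute)
      finally show ?thesis .
    qed
    then have "?f x \<le> (real m / 2) powr p * (cmod (horizontal x) ^ (4 * m\<^sup>2 + m)) powr p"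
      by (intro mult_left_mono) auto
    also have "\<dots> = (real m / 2 * cmod (horizontal x) ^ (4 * m\<^sup>2 + m)) powr p"
      by (subst powr_mult) auto
    also have "\<dots> \<le> ?G x powr p"
      using p by (intro powr_mono2 maximal_function_lower_bound x) auto
    finally show ?thesis .
  qed
  moreover have "0 \<le> ?G x" if "x \<in> S2" for x
    using maximal_function_lower_bound[OF that, of m] by (rule order_trans[rotated]) simp
  ultimately have "(LINT x|sphere_measure. ?f x) powr (1 / p) \<le> Lp_norm p ?G"
    using p by (intro Lp_norm_mono continuous_intros cont G) auto
  moreover have "c * real m powr (1 - 1 / p) \<le> (LINT x|sphere_measure. ?f x) powr (1 / p)"
  proof -
    have "2 * real L + 1 \<le> 3 * real q * (real m)\<^sup>2"
    proof -
      have "1 \<le> real L"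
        using L(1) by linarith
      then show ?thesis
        by (simp add: L_def)
    qed
    then have "sqrt (2 * real L + 1) \<le> sqrt (3 * real q) * real m"
      by (metis real_sqrt_le_mono real_sqrt_mult real_sqrt_abs abs_of_nat)
    then have "highest_weight_mass 0 / (sqrt (3 * real q) * real m) \<le> highest_weight_mass 0 / sqrt (2 * real L + 1)"
      using highest_weight_mass_0_pos m q
      by (intro divide_left_mono) (auto intro!: mult_pos_pos add_nonneg_pos)
    also have "\<dots> \<le> highest_weight_mass L"
      by (rule highest_weight_mass_bounds)
    finally have "highest_weight_mass 0 / sqrt (3 * real q) / real m \<le> highest_weight_mass L"
      by simp
    then have "(real m / 2) powr p * (highest_weight_mass 0 / sqrt (3 * real q) / real m) \<le> (LINT x|sphere_measure. ?f x)"
      unfolding highest_weight_mass_def by (simp only: integral_mult_right_zero mult_left_mono powr_ge_zero)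
    then have "((real m / 2) powr p * (highest_weight_mass 0 / sqrt (3 * real q) / real m)) powr (1 / p)
        \<le> (LINT x|sphere_measure. ?f x) powr (1 / p)"
      using p highest_weight_mass_0_pos by (intro powr_mono2) auto
    moreover have "((real m / 2) powr p * (highest_weight_mass 0 / sqrt (3 * real q) / real m)) powr (1 / p)
        = c * real m powr (1 - 1 / p)"
      using p m highest_weight_mass_0_pos
      by (simp add: c_def powr_mult powr_divide powr_powr powr_diff mult_ac)
    ultimately show ?thesis
      by simp
  qed
  ultimately show "c * real m powr (1 - 1 / p) \<le> Lp_norm p ?G"
    by linarith
qed

text \<open>There are \<open>m + 1\<close> orthogonal terms, each with squared norm of order \<open>1 / m\<close> and weight
  \<open>(1 + n (n + 1))\<^sup>s\<close> of order \<open>m\<^sup>4\<^sup>s\<close>.\<close>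
lemma sobolev_norm_wave_packet_upper_bound:
  "\<exists>C>0. \<forall>m\<ge>1. sobolev_norm s (wave_packet m) \<le> C * real m powr (2 * s)"
proof (intro exI conjI allI impI)
  let ?C = "31 powr \<bar>s\<bar> * highest_weight_mass 0"
  show "sqrt ?C > 0"
    using highest_weight_mass_0_pos by simp
  fix m :: nat
  assume m: "1 \<le> m"
  let ?A = "{4 * m\<^sup>2..4 * m\<^sup>2 + m}"
  have weight: "(1 + real k * (real k + 1)) powr s \<le> 31 powr \<bar>s\<bar> * real m powr (4 * s)" if k: "k \<in> ?A" for k
  proof -
    \<comment> \<open>On the band, \<open>1 + k (k + 1)\<close> lies between \<open>m\<^sup>4\<close> and \<open>31 m\<^sup>4\<close>; the lower bound serves negative \<open>s\<close>.\<close>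
    let ?\<mu> = "1 + real k * (real k + 1)"
    have m2: "1 \<le> (real m)\<^sup>2" "real m \<le> (real m)\<^sup>2"
      using m by (auto intro: self_le_power)
    have k': "4 * (real m)\<^sup>2 \<le> real k" "real k \<le> 4 * (real m)\<^sup>2 + real m"
    proof -
      have "real (4 * m\<^sup>2) \<le> real k" "real k \<le> real (4 * m\<^sup>2 + m)"
        using k by (simp_all only: of_nat_le_iff atLeastAtMost_iff)
      then show "4 * (real m)\<^sup>2 \<le> real k" "real k \<le> 4 * (real m)\<^sup>2 + real m"
        by simp_all
    qed
    have m4: "(real m)\<^sup>2 * (real m)\<^sup>2 = real m ^ 4" "1 \<le> real m ^ 4"
      using m by (auto simp flip: power_add intro: one_le_power)
    have k5: "(real m)\<^sup>2 \<le> real k" "real k \<le> 5 * (real m)\<^sup>2" "real k + 1 \<le> 6 * (real m)\<^sup>2"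
      using k' m2 by linarith+
    have "real m ^ 4 \<le> real k * real k"
      unfolding m4(1)[symmetric] by (intro mult_mono k5) auto
    then have lo: "real m ^ 4 \<le> ?\<mu>"
      by (simp add: algebra_simps)
    have "real k * (real k + 1) \<le> (5 * (real m)\<^sup>2) * (6 * (real m)\<^sup>2)"
      by (intro mult_mono k5) auto
    then have hi: "?\<mu> \<le> 31 * real m ^ 4"
      using m4 by (simp add: algebra_simps)
    have pow: "(real m ^ 4) powr s = real m powr (4 * s)"
    proof -
      have "real m ^ 4 = real m powr 4"
        using m by simp
      then show ?thesis
        by (simp only: powr_powr)
    qed
    show ?thesis
    proof (cases "0 \<le> s")
      case True
      then have "?\<mu> powr s \<le> (31 * real m ^ 4) powr s"
        using hi by (intro powr_mono2) auto
      then show ?thesis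
        using True by (simp add: powr_mult pow)
    next
      case False
      then have "?\<mu> powr s \<le> 1 * (real m ^ 4) powr s"
        using lo m by (simp add: powr_mono2')
      also have "\<dots> \<le> 31 powr \<bar>s\<bar> * (real m ^ 4) powr s"
        by (intro mult_right_mono) (auto intro: ge_one_powr_ge_zero)
      finally show ?thesis
        by (simp add: pow)
    qed
  qed
  have mass: "highest_weight_mass k \<le> highest_weight_mass 0 / (2 * real m)" if k: "k \<in> ?A" for k
  proof -
    have "real (4 * m\<^sup>2) \<le> real k"
      using k by (simp only: of_nat_le_iff atLeastAtMost_iff)
    then have "2 * real m \<le> sqrt (real k + 1)"
      by (intro real_le_rsqrt) (simp add: power_mult_distrib)
    then have "highest_weight_mass 0 / sqrt (real k + 1) \<le> highest_weight_mass 0 / (2 * real m)"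
      using highest_weight_mass_0_pos m by (intro divide_left_mono) auto
    then show ?thesis
      using highest_weight_mass_bounds(2)[of k] by linarith
  qed
  have "sobolev_norm s (wave_packet m) = sqrt (\<Sum>k\<in>?A. (1 + real k * (real k + 1)) powr s * highest_weight_mass k)"
    unfolding wave_packet_def[abs_def] highest_weight_mass_def
    by (subst sobolev_norm_sum) (auto simp: highest_weight_spherical_harmonics norm_power power_mult[symmetric] mult.commute)
  also have "\<dots> \<le> sqrt (\<Sum>k\<in>?A. 31 powr \<bar>s\<bar> * real m powr (4 * s) * (highest_weight_mass 0 / (2 * real m)))"
    by (intro real_sqrt_le_mono sum_mono mult_mono weight mass)
      (auto simp: highest_weight_mass_def intro!: integral_nonneg_AE)
  also have "\<dots> = sqrt ((real m + 1) / (2 * real m) * (?C * real m powr (4 * s)))"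
    by simp
  also have "\<dots> \<le> sqrt (1 * (?C * real m powr (4 * s)))"
    using m highest_weight_mass_0_pos by (intro real_sqrt_le_mono mult_right_mono) auto
  also have "\<dots> = sqrt ?C * real m powr (2 * s)"
    by (simp add: real_sqrt_mult powr_powr flip: powr_half_sqrt)
  finally show "sobolev_norm s (wave_packet m) \<le> sqrt ?C * real m powr (2 * s)" .
qed

theorem theorem1p1:
  fixes p s :: real
  assumes "2 \<le> p"
    and "s < 1 / 2 - 1 / (2 * p)"
  shows "\<not> (\<exists>C>0. \<forall>\<phi>. smooth_on_S2 \<phi> \<longrightarrow>
           Lp_norm p (\<lambda>x. SUP t\<in>{0..2 * pi}. cmod (schroedinger t \<phi> x)) \<le> C * sobolev_norm s \<phi>)"
proof
  assume "\<exists>C>0. \<forall>\<phi>. smooth_on_S2 \<phi> \<longrightarrow>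
    Lp_norm p (\<lambda>x. SUP t\<in>{0..2 * pi}. cmod (schroedinger t \<phi> x)) \<le> C * sobolev_norm s \<phi>"
  then obtain C where C: "C > 0" and est: "\<And>\<phi>. smooth_on_S2 \<phi> \<Longrightarrow>
      Lp_norm p (\<lambda>x. SUP t\<in>{0..2 * pi}. cmod (schroedinger t \<phi> x)) \<le> C * sobolev_norm s \<phi>"
    by blast
  obtain c where c: "c > 0" and lower: "\<And>m. 1 \<le> m \<Longrightarrow> c * real m powr (1 - 1 / p)
      \<le> Lp_norm p (\<lambda>x. SUP t\<in>{0..2 * pi}. cmod (schroedinger t (wave_packet m) x))"
    using maximal_function_Lp_lower_bound[OF assms(1)] by blast
  obtain K where K: "K > 0" and upper: "\<And>m. 1 \<le> m \<Longrightarrow> sobolev_norm s (wave_packet m) \<le> K * real m powr (2 * s)"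
    using sobolev_norm_wave_packet_upper_bound by blast
  \<comment> \<open>By the hypothesis on \<open>s\<close>, this excess of the lower over the upper exponent is positive.\<close>
  define e where "e = 1 - 1 / p - 2 * s"
  have e: "e > 0"
    using assms by (simp add: e_def field_simps)
  have bounded: "real m powr e \<le> C * K / c" if m: "1 \<le> m" for m
  proof -
    have "c * real m powr (1 - 1 / p) \<le> C * sobolev_norm s (wave_packet m)"
      using lower[OF m] est[OF smooth_on_S2_polynomial_function[OF polynomial_function_wave_packet]]
      by (rule order_trans)
    also have "\<dots> \<le> C * (K * real m powr (2 * s))"
      using C upper[OF m] by (intro mult_left_mono) auto
    finally have "c * (real m powr (2 * s) * real m powr e) \<le> C * K * real m powr (2 * s)"
      by (simp add: e_def algebra_simps flip: powr_add)
    then have "real m powr (2 * s) * (c * real m powr e) \<le> real m powr (2 * s) * (C * K)"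
      by (simp only: mult_ac)
    then show ?thesis
      using m c by (simp add: mult_le_cancel_left_pos pos_le_divide_eq mult.commute)
  qed
  obtain m where m: "max 1 ((C * K / c) powr (1 / e)) < real m"
    using reals_Archimedean2 by blast
  then have "((C * K / c) powr (1 / e)) powr e < real m powr e"
    using e by (intro powr_less_mono2) auto
  then have "C * K / c < real m powr e"
    using e C K c by (simp add: powr_powr)
  moreover have "real m powr e \<le> C * K / c"
    using m by (intro bounded) auto
  ultimately show False
    by linarith
qed

end
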